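(* Let $n\ge 1$ and $p\in\{0,1,2,\dots\}\cup\{+\infty\}$. For every fixed point $\zeta\in\mathbb{T}^n$, the set of functions in $A^p(D^n)$ that are not real analytic at $\zeta$ is a dense $G_\delta$ subset of $A^p(D^n)$. Likewise, the set of functions in $A^p(D^n)$ that are real analytic at no point of $\mathbb{T}^n$ is a dense $G_\delta$ subset of $A^p(D^n)$.
   Context: $D$ is the open unit disc and $\mathbb{T}$ the unit circle in $\mathbb{C}$. $A^p(D^n)$ is the set of holomorphic functions $f:D^n\to\mathbb{C}$ such that $\frac{\partial^{\alpha}f}{\partial z^{\alpha}}$ extends continuously to $\overline{D^n}$ for every multi-index $\alpha\in\mathbb{N}^n$ with $|\alpha|\le p$ (all $\alpha$ if $p=+\infty$). Its topology is given by the seminorms $|f|_{\alpha}=\sup_{z\in D^n}\left|\frac{\partial^{\alpha}f}{\partial z^{\alpha}}(z)\right|$, $|\alpha|\le p$. A function $g:\mathbb{T}^n\to\mathbb{C}$ is real analytic at $(e^{i\theta_1},\dots,e^{i\theta_n})$, $\theta_i\in\mathbb{R}$, if there are $\delta>0$ and a power series $I(t_1,\dots,t_n)=\sum_{k_1,\dots,k_n\ge0}a_{k_1,\dots,k_n}(t_1-\theta_1)^{k_1}\cdots(t_n-\theta_n)^{k_n}$ (complex coefficients) converging absolutely and uniformly on $\prod_{i=1}^n[\theta_i-\delta,\theta_i+\delta]$ with $I(t_1,\dots,t_n)=g(e^{it_1},\dots,e^{it_n})$ there. A function $f\in A^p(D^n)$ is real analytic at $\zeta\in\mathbb{T}^n$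 if the restriction to $\mathbb{T}^n$ of its continuous extension to $\overline{D^n}$ is real analytic at $\zeta$. *)

theory Defs
  imports "HOL-Analysis.Analysis" "HOL-Library.Extended_Nat"
begin

definition polydisc :: "(complex ^ 'n::finite) set" where
  "polydisc = {z. \<forall>i. norm (z $ i) < 1}"

definition torus :: "(complex ^ 'n::finite) set" where
  "torus = {z. \<forall>i. norm (z $ i) = 1}"

text \<open>On an open set, holomorphy in several variables means that the real Frechet
  derivative exists everywhere and is complex linear.\<close>

definition mholomorphic_on :: "(complex ^ 'n::finite \<Rightarrow> complex) \<Rightarrow> (complex ^ 'n) set \<Rightarrow> bool" where
  "mholomorphic_on f S \<longleftrightarrow>
     (\<forall>z\<in>S. \<exists>L. (f has_derivative L) (at z) \<and> (\<forall>c v. L (c *s v) = c * L v))"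

definition partial_deriv :: "'n::finite \<Rightarrow> (complex ^ 'n \<Rightarrow> complex) \<Rightarrow> complex ^ 'n \<Rightarrow> complex" where
  "partial_deriv i f = (\<lambda>z. deriv (\<lambda>w. f (z + axis i w)) 0)"

text \<open>The index type carries no order, so iterated partial derivatives are taken along an
  arbitrary but fixed enumeration of it. On an open set where the function is holomorphic,
  the order is irrelevant.\<close>

definition index_list :: "'n::finite list" where
  "index_list = (SOME xs. distinct xs \<and> set xs = UNIV)"

lemma index_list: "distinct (index_list :: 'n::finite list)" "set (index_list :: 'n list) = UNIV"
proof -
  have "\<exists>xs :: 'n list. distinct xs \<and> set xs = UNIV"
    using finite_distinct_list[of "UNIV :: 'n set"] by auto
  then have "distinct (index_list :: 'n list) \<and> set (index_list :: 'n list) = UNIV"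
    unfolding index_list_def by (rule someI_ex)
  then show "distinct (index_list :: 'n list)" "set (index_list :: 'n list) = UNIV" by auto
qed

definition multi_deriv ::
  "('n::finite \<Rightarrow> nat) \<Rightarrow> (complex ^ 'n \<Rightarrow> complex) \<Rightarrow> complex ^ 'n \<Rightarrow> complex" where
  "multi_deriv \<alpha> f = foldr (\<lambda>i. partial_deriv i ^^ \<alpha> i) index_list f"

definition extends_to_closure :: "(complex ^ 'n::finite \<Rightarrow> complex) \<Rightarrow> (complex ^ 'n \<Rightarrow> complex) \<Rightarrow> bool" where
  "extends_to_closure f g \<longleftrightarrow>
     continuous_on (closure polydisc) g \<and> (\<forall>z\<in>polydisc. g z = f z)"

definition cont_extension :: "(complex ^ 'n::finite \<Rightarrow> complex) \<Rightarrow> complex ^ 'n \<Rightarrow> complex" where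
  "cont_extension f = (SOME g. extends_to_closure f g)"

definition mindices :: "enat \<Rightarrow> ('n::finite \<Rightarrow> nat) set" where
  "mindices p = {\<alpha>. enat (\<Sum>i\<in>UNIV. \<alpha> i) \<le> p}"

text \<open>Elements are functions on the open polydisc only; \<open>extensional\<close> fixes the irrelevant
  values outside it, so that equality of elements is equality on the polydisc.\<close>

definition Ap :: "enat \<Rightarrow> (complex ^ 'n::finite \<Rightarrow> complex) set" where
  "Ap p = {f \<in> extensional polydisc. mholomorphic_on f polydisc \<and>
             (\<forall>\<alpha>\<in>mindices p. \<exists>g. extends_to_closure (multi_deriv \<alpha> f) g)}"

definition Ap_seminorm :: "('n::finite \<Rightarrow> nat) \<Rightarrow> (complex ^ 'n \<Rightarrow> complex) \<Rightarrow> real" where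
  "Ap_seminorm \<alpha> f = (SUP z\<in>polydisc. norm (multi_deriv \<alpha> f z))"

definition Ap_topology :: "enat \<Rightarrow> (complex ^ 'n::finite \<Rightarrow> complex) topology" where
  "Ap_topology p = topology_generated_by
     {{g \<in> Ap p. Ap_seminorm \<alpha> (\<lambda>z. g z - f z) < \<epsilon>} | f \<alpha> \<epsilon>. f \<in> Ap p \<and> \<alpha> \<in> mindices p \<and> 0 < \<epsilon>}"

lemma topspace_Ap_topology: "topspace (Ap_topology p) = (Ap p :: (complex ^ 'n::finite \<Rightarrow> complex) set)"
proof -
  have pow0: "foldr (\<lambda>i. partial_deriv i ^^ 0) xs h = h" for xs :: "'n list" and h
    by (induction xs) auto
  have z: "Ap_seminorm (\<lambda>_::'n. 0) (\<lambda>z. f z - f z) < 1" for f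
  proof -
    have "(0 :: complex ^ 'n) \<in> polydisc" by (simp add: polydisc_def)
    then have "(\<lambda>z :: complex ^ 'n. 0 :: real) ` polydisc = {0}" by auto
    then show ?thesis by (simp add: Ap_seminorm_def multi_deriv_def pow0[simplified])
  qed
  have i: "(\<lambda>_::'n. 0) \<in> mindices p" by (simp add: mindices_def flip: zero_enat_def)
  have "f \<in> topspace (Ap_topology p)" if "f \<in> Ap p" for f :: "complex ^ 'n \<Rightarrow> complex"
    unfolding Ap_topology_def topology_generated_by_topspace
    using that z[of f] i zero_less_one by blast
  moreover have "topspace (Ap_topology p) \<subseteq> (Ap p :: (complex ^ 'n \<Rightarrow> complex) set)"
    unfolding Ap_topology_def topology_generated_by_topspace by blast
  ultimately show ?thesis by blast
qed

definition mpower_term :: "(('n::finite \<Rightarrow> nat) \<Rightarrow> complex) \<Rightarrow> real ^ 'n \<Rightarrow> real ^ 'n \<Rightarrow> ('n \<Rightarrow> nat) \<Rightarrow> complex" where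
  "mpower_term a \<theta> t k = a k * of_real (\<Prod>i\<in>UNIV. (t $ i - \<theta> $ i) ^ k i)"

text \<open>Uniform convergence of the multiple series is along the net of all finite sets of
  multi-indices.\<close>

definition real_analytic_at :: "(complex ^ 'n::finite \<Rightarrow> complex) \<Rightarrow> complex ^ 'n \<Rightarrow> bool" where
  "real_analytic_at g \<zeta> \<longleftrightarrow>
     (\<exists>\<theta> :: real ^ 'n. \<exists>\<delta>>0. \<exists>a. \<zeta> = (\<chi> i. cis (\<theta> $ i)) \<and>
        (let B = cbox (\<chi> i. \<theta> $ i - \<delta>) (\<chi> i. \<theta> $ i + \<delta>) in
          (\<forall>t\<in>B. (\<lambda>k. norm (mpower_term a \<theta> t k)) summable_on UNIV) \<and>
          uniform_limit B (\<lambda>K t. \<Sum>k\<in>K. mpower_term a \<theta> t k)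
            (\<lambda>t. \<Sum>\<^sub>\<infinity>k. mpower_term a \<theta> t k) (finite_subsets_at_top UNIV) \<and>
          (\<forall>t\<in>B. (\<Sum>\<^sub>\<infinity>k. mpower_term a \<theta> t k) = g (\<chi> i. cis (t $ i)))))"

definition Ap_real_analytic_at :: "(complex ^ 'n::finite \<Rightarrow> complex) \<Rightarrow> complex ^ 'n \<Rightarrow> bool" where
  "Ap_real_analytic_at f \<zeta> \<longleftrightarrow> real_analytic_at (cont_extension f) \<zeta>"

definition dense_gdelta_in :: "'a topology \<Rightarrow> 'a set \<Rightarrow> bool" where
  "dense_gdelta_in X S \<longleftrightarrow> gdelta_in X S \<and> X closure_of S = topspace X"

end

theory Submission
  imports Defs "HOL-Complex_Analysis.Complex_Analysis" "HOL-Real_Asymp.Real_Asymp"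
begin

text \<open>
  Why the theorem holds. For both parts the set in question consists of the functions that are
  analytic at no point of a compact set \<open>Z\<close>, namely a single point or the whole torus.

  Its complement is a countable union of closed sets. A function is real analytic at \<open>\<zeta>\<close> if and only
  if, for some positive integer \<open>m\<close>, it is given near \<open>\<zeta>\<close>, on a cube whose size depends only on \<open>m\<close>, by a
  power series whose coefficients satisfy geometric bounds depending only on \<open>m\<close>
  (\<open>real_analytic_at_iff_has_chart\<close>). For fixed \<open>m\<close> these coefficient families form a compact space, and
  agreement of function and power series is a closed condition on the function, the base point and
  the coefficients together. Projecting along the compact space of base points in \<open>Z\<close> and coefficients
  gives a closed set of functions (\<open>closedin_has_chart\<close>).

  Density comes from an explicit perturbation. There is a lacunary power series \<open>h\<close> in one variable
  with all derivatives continuous on the closed disc whose restriction to the circle is analytic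
  at no point: suitable derivatives along the circle are dominated at every point by one term, and
  that term is too large for Cauchy's inequality (\<open>boundary_not_analytic\<close>). Given \<open>f\<close>, consider
  \<open>f + c * h\<close> with \<open>h\<close> applied to one coordinate. If two of these functions, for different \<open>c\<close>, were
  analytic in the angle of that coordinate at the same point, so would be \<open>h\<close>. Real analyticity at one
  point implies analyticity in that angle on an open set, which meets a fixed countable dense set.
  So only countably many \<open>c\<close> make \<open>f + c * h\<close> analytic somewhere on the torus
  (\<open>countable_analytic_perturbations\<close>), and arbitrarily small \<open>c\<close> remain. The set for the whole torus is
  therefore dense, and so is the larger set for a single point.
\<close>

section \<open>A lacunary series that is nowhere analytic on the circle\<close>

text \<open>The frequencies are squares of their predecessors, and the weights decay faster than every
  power of the frequency, so that the lacunary series and all its derivatives converge uniformly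
  on the closed disc. The exponent \<open>2 * j\<close> in the weight separates the terms: in the derivative of
  order \<open>2 * K + 5\<close> along the circle, term \<open>j\<close> has modulus \<open>freq j\<close> to the power \<open>2 * (K - j) + 5\<close>,
  which is far largest at \<open>j = K + 1\<close>.\<close>

definition freq :: "nat \<Rightarrow> nat" where
  "freq j = 2 ^ 2 ^ j"

definition weight :: "nat \<Rightarrow> real" where
  "weight j = 1 / real (freq j) ^ (2 * j)"

lemma freq_ge_2: "2 \<le> freq j"
  using power_increasing[of 1 "2 ^ j" "2::nat"] by (simp add: freq_def)

lemma freq_add: "freq (j + i) = freq j ^ 2 ^ i"
  by (simp add: freq_def power_add power_mult)

lemma weight_pos: "0 < weight j"
  using freq_ge_2[of j] by (simp add: weight_def)

lemma weight_times_freq_power_le: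
  assumes "m < 2 * j"
  shows "weight j * real (freq j) ^ m \<le> (1 / 2) ^ (2 * j - m)"
proof -
  have "weight j * real (freq j) ^ m = (1 / real (freq j)) ^ (2 * j - m)"
    using assms freq_ge_2[of j] by (simp add: weight_def power_diff power_one_over field_simps)
  also have "\<dots> \<le> (1 / 2) ^ (2 * j - m)"
    using freq_ge_2[of j] by (intro power_mono divide_left_mono) auto
  finally show ?thesis .
qed

lemma summable_weight_freq_power: "summable (\<lambda>j. weight j * real (freq j) ^ m)"
proof (rule summable_comparison_test_ev)
  show "\<forall>\<^sub>F j in sequentially. norm (weight j * real (freq j) ^ m) \<le> (1 / 2) ^ j"
    using eventually_ge_at_top[of "Suc m"]
  proof eventually_elim
    case (elim j)
    have "weight j * real (freq j) ^ m \<le> (1 / 2) ^ (2 * j - m)"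
      using elim by (intro weight_times_freq_power_le) simp
    also have "\<dots> \<le> (1 / 2) ^ j"
      using elim by (intro power_decreasing) auto
    finally show ?case
      using weight_pos[of j] by simp
  qed
qed (simp add: summable_geometric)

text \<open>The \<open>m\<close>-th derivative of \<open>weight j * z ^ freq j\<close>, with the falling factorial written as a
  product of truncated differences: it vanishes as soon as \<open>m\<close> exceeds \<open>freq j\<close>.\<close>

definition lacunary_term :: "nat \<Rightarrow> nat \<Rightarrow> complex \<Rightarrow> complex" where
  "lacunary_term m j z = of_real (weight j) * of_nat (\<Prod>l<m. freq j - l) * z ^ (freq j - m)"

definition lacunary :: "nat \<Rightarrow> complex \<Rightarrow> complex" where
  "lacunary m z = (\<Sum>j. lacunary_term m j z)"

lemma norm_lacunary_term_le:
  assumes "norm z \<le> 1"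
  shows "norm (lacunary_term m j z) \<le> weight j * real (freq j) ^ m"
proof -
  have "(\<Prod>l<m. freq j - l) \<le> (\<Prod>l<m. freq j)"
    by (intro prod_mono) auto
  then have "real (\<Prod>l<m. freq j - l) \<le> real (freq j) ^ m"
    by (metis card_lessThan of_nat_le_iff of_nat_power prod_constant)
  then have "weight j * real (\<Prod>l<m. freq j - l) * norm z ^ (freq j - m)
      \<le> weight j * real (freq j) ^ m * 1"
    using assms weight_pos[of j]
    by (intro mult_mono power_le_one) (auto simp del: of_nat_prod)
  then show ?thesis
    using weight_pos[of j] unfolding lacunary_term_def norm_mult norm_power norm_of_nat norm_of_real
    by (simp del: of_nat_prod)
qed

lemma uniform_limit_lacunary:
  "uniform_limit (cball 0 1) (\<lambda>n z. \<Sum>j<n. lacunary_term m j z) (lacunary m) sequentially"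
  unfolding lacunary_def
  by (rule Weierstrass_m_test[OF _ summable_weight_freq_power[of m]])
     (simp add: norm_lacunary_term_le)

lemma continuous_on_lacunary: "continuous_on (cball 0 1) (lacunary m)"
  by (rule uniform_limit_theorem[OF _ uniform_limit_lacunary])
     (auto simp: lacunary_term_def intro!: always_eventually continuous_intros)

lemma summable_lacunary:
  assumes "norm z \<le> 1"
  shows "summable (\<lambda>j. lacunary_term m j z)"
  by (rule summable_comparison_test[OF _ summable_weight_freq_power[of m]])
     (use norm_lacunary_term_le[OF assms] in blast)

lemma has_field_derivative_lacunary:
  assumes "z \<in> ball 0 1"
  shows "(lacunary m has_field_derivative lacunary (Suc m) z) (at z)"
  unfolding lacunary_def
proof (rule has_field_derivative_series'(2)[where S = "ball 0 1" and ?x0.0 = 0])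
  fix j :: nat and w :: complex
  show "(lacunary_term m j has_field_derivative lacunary_term (Suc m) j w) (at w within ball 0 1)"
    unfolding lacunary_term_def
    by (auto intro!: derivative_eq_intros simp: mult_ac)
next
  show "uniformly_convergent_on (ball 0 1) (\<lambda>n z. \<Sum>j<n. lacunary_term (Suc m) j z)"
    using uniform_limit_on_subset[OF uniform_limit_lacunary[of "Suc m"], of "ball 0 1"]
    by (auto simp: uniformly_convergent_on_def)
qed (use assms summable_lacunary[of 0] in auto)

lemma higher_deriv_lacunary:
  assumes "z \<in> ball 0 1"
  shows "(deriv ^^ m) (lacunary 0) z = lacunary m z"
  using assms
proof (induction m arbitrary: z)
  case (Suc m)
  have "\<forall>\<^sub>F w in nhds z. (deriv ^^ m) (lacunary 0) w = lacunary m w"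
    using eventually_nhds_in_open[OF open_ball Suc.prems] by eventually_elim (rule Suc.IH)
  then have "deriv ((deriv ^^ m) (lacunary 0)) z = deriv (lacunary m) z"
    by (intro deriv_cong_ev) auto
  then show ?case
    using DERIV_imp_deriv[OF has_field_derivative_lacunary[OF Suc.prems]] by simp
qed simp

lemma holomorphic_lacunary: "lacunary m holomorphic_on ball 0 1"
  by (rule holomorphic_onI) (meson field_differentiable_at_within field_differentiable_def has_field_derivative_lacunary)

text \<open>The same series read along the circle: with \<open>z = exp (\<i> * x)\<close> the \<open>m\<close>-th derivative is now
  taken with respect to the angle \<open>x\<close>. The angle is a complex variable because a germ that is
  analytic in the angle gets compared with it through complex derivatives within \<open>\<real>\<close>.\<close>

definition boundary_term :: "nat \<Rightarrow> nat \<Rightarrow> complex \<Rightarrow> complex" where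
  "boundary_term m j x = of_real (weight j) * (\<i> * of_nat (freq j)) ^ m * exp (\<i> * of_nat (freq j) * x)"

definition boundary_series :: "nat \<Rightarrow> complex \<Rightarrow> complex" where
  "boundary_series m x = (\<Sum>j. boundary_term m j x)"

lemma norm_boundary_term:
  assumes "x \<in> \<real>"
  shows "norm (boundary_term m j x) = weight j * real (freq j) ^ m"
proof -
  have "Re (\<i> * of_nat (freq j) * x) = 0"
    using assms by (simp add: complex_is_Real_iff)
  then have "norm (exp (\<i> * of_nat (freq j) * x)) = 1"
    by (simp only: norm_exp_eq_Re exp_zero)
  then show ?thesis
    using weight_pos[of j] by (simp add: boundary_term_def norm_mult norm_power)
qed

lemma summable_boundary_term: "x \<in> \<real> \<Longrightarrow> summable (\<lambda>j. boundary_term m j x)"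
  by (rule summable_norm_cancel) (simp add: norm_boundary_term summable_weight_freq_power)

lemma lacunary_on_circle: "lacunary 0 (cis x) = boundary_series 0 (of_real x)"
  by (simp add: lacunary_def boundary_series_def lacunary_term_def boundary_term_def cis_conv_exp
      exp_of_nat_mult[symmetric] mult_ac)

lemma has_field_derivative_boundary_series:
  assumes "x \<in> \<real>"
  shows "(boundary_series m has_field_derivative boundary_series (Suc m) x) (at x within \<real>)"
proof -
  have "\<exists>g. \<forall>x\<in>\<real>. (\<lambda>j. boundary_term m j x) sums g x \<and>
      (g has_field_derivative boundary_series (Suc m) x) (at x within \<real>)"
  proof (rule has_field_derivative_series[where ?x0.0 = 0])
    show "convex (\<real> :: complex set)"
      by (auto simp: convex_def scaleR_conv_of_real)
    show "(boundary_term m j has_field_derivative boundary_term (Suc m) j x) (at x within \<real>)" for j x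
      unfolding boundary_term_def by (auto intro!: derivative_eq_intros simp: mult_ac)
    show "uniform_limit \<real> (\<lambda>n x. \<Sum>j<n. boundary_term (Suc m) j x) (boundary_series (Suc m)) sequentially"
      unfolding boundary_series_def
      by (rule Weierstrass_m_test[OF _ summable_weight_freq_power[of "Suc m"]])
         (simp add: norm_boundary_term)
  qed (auto intro: summable_boundary_term)
  then obtain g where g: "\<And>x. x \<in> \<real> \<Longrightarrow> (\<lambda>j. boundary_term m j x) sums g x"
    "\<And>x. x \<in> \<real> \<Longrightarrow> (g has_field_derivative boundary_series (Suc m) x) (at x within \<real>)"
    by blast
  have "g x = boundary_series m x" if "x \<in> \<real>" for x
    using g(1)[OF that] by (simp add: boundary_series_def sums_unique)
  then show ?thesis
    by (intro has_field_derivative_transform_within[OF g(2)[OF assms] zero_less_one assms]) simp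
qed

text \<open>At every angle a single term of the derivative outweighs all others together. With
  \<open>N = freq K\<close>, the term \<open>K + 1\<close> has modulus \<open>N ^ 6\<close>, each earlier one at most \<open>N ^ 5\<close>, the next
  one \<open>N ^ 4\<close>, and the rest sum up to at most \<open>1\<close>.\<close>

lemma norm_boundary_series_ge:
  assumes "2 \<le> K" "x \<in> \<real>"
  shows "real (freq K) \<le> norm (boundary_series (2 * K + 5) x)"
proof -
  define m where "m = 2 * K + 5"
  define T where "T j = weight j * real (freq j) ^ m" for j
  define N where "N = real (freq K)"
  define b where "b j = boundary_term m j x" for j
  have nb: "norm (b j) = T j" for j
    using assms(2) by (simp add: b_def T_def norm_boundary_term)
  have N2: "2 \<le> N"
    using freq_ge_2[of K] by (simp add: N_def)
  have T_eq: "T j = real (freq j) ^ (m - 2 * j)" if "2 * j \<le> m" for j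
    using that freq_ge_2[of j] by (simp add: T_def weight_def power_diff)
  \<comment> \<open>By squaring, \<open>N = freq j ^ 2 ^ i\<close> for \<open>i = K - j\<close>, while the exponent of \<open>freq j\<close> is only \<open>2 * i + 5\<close>.\<close>
  have low: "T j \<le> N ^ 5" if "j \<le> K" for j
  proof -
    define i where "i = K - j"
    have "i < 2 ^ i" by (rule less_exp)
    then have *: "2 * i + 5 \<le> 2 ^ i * 5"
      by linarith
    have "T j = real (freq j) ^ (2 * i + 5)"
      using that by (simp add: T_eq m_def i_def algebra_simps)
    also have "\<dots> \<le> real (freq j) ^ (2 ^ i * 5)"
      using * freq_ge_2[of j] by (intro power_increasing) auto
    also have "\<dots> = N ^ 5"
      using freq_add[of j i] that by (simp add: N_def i_def power_mult)
    finally show ?thesis .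
  qed
  have "m - 2 * (K + 1) = 3" "m - 2 * (K + 2) = 1" "2 * (K + 1) \<le> m" "2 * (K + 2) \<le> m"
    by (auto simp: m_def)
  moreover have "real (freq (K + 1)) = N ^ 2" "real (freq (K + 2)) = N ^ 4"
    unfolding N_def freq_add by simp_all
  ultimately have main: "T (K + 1) = N ^ 6" and next1: "T (K + 2) = N ^ 4"
    using T_eq[of "K + 1"] T_eq[of "K + 2"] by (simp_all only: power_mult[symmetric]) simp_all
  have far: "T (j + (K + 3)) \<le> (1 / 2) ^ Suc j" for j
  proof -
    have "T (j + (K + 3)) \<le> (1 / 2) ^ (2 * (j + (K + 3)) - m)"
      unfolding T_def by (rule weight_times_freq_power_le) (simp add: m_def)
    also have "\<dots> \<le> (1 / 2) ^ Suc j"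
      by (intro power_decreasing) (auto simp: m_def)
    finally show ?thesis .
  qed
  have sT: "summable T"
    unfolding T_def by (rule summable_weight_freq_power)
  have tail: "norm (\<Sum>j. b (j + (K + 3))) \<le> 1"
  proof -
    have "norm (\<Sum>j. b (j + (K + 3))) \<le> (\<Sum>j. T (j + (K + 3)))"
      using summable_ignore_initial_segment[OF sT, of "K + 3"]
      by (intro order.trans[OF summable_norm]) (simp_all add: nb)
    also have "\<dots> \<le> (\<Sum>j. (1 / 2 :: real) ^ Suc j)"
      using summable_ignore_initial_segment[OF sT, of "K + 3"] power_half_series
      by (intro suminf_le far) (auto simp: sums_iff)
    also have "\<dots> = 1"
      using power_half_series by (simp add: sums_iff)
    finally show ?thesis .
  qed
  have sb: "summable b"
    unfolding b_def using assms(2) by (rule summable_boundary_term)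
  have "suminf b = (\<Sum>j. b (j + (K + 3))) + (\<Sum>j<K + 3. b j)"
    by (rule suminf_split_initial_segment[OF sb])
  also have "(\<Sum>j<K + 3. b j) = (\<Sum>j<K + 1. b j) + b (K + 1) + b (K + 2)"
    by (simp add: numeral_3_eq_3)
  finally have eq: "b (K + 1) = suminf b - (\<Sum>j. b (j + (K + 3))) - (\<Sum>j<K + 1. b j) - b (K + 2)"
    by simp
  have triangle: "norm (u - v - w - y) \<le> norm u + norm v + norm w + norm y" for u v w y :: complex
    using norm_triangle_ineq4[of u v] norm_triangle_ineq4[of "u - v" w]
      norm_triangle_ineq4[of "u - v - w" y] by linarith
  have "norm (b (K + 1)) \<le> norm (suminf b) + norm (\<Sum>j. b (j + (K + 3)))
      + norm (\<Sum>j<K + 1. b j) + norm (b (K + 2))"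
    unfolding eq by (rule triangle)
  moreover have "norm (\<Sum>j<K + 1. b j) \<le> (\<Sum>j<K + 1. N ^ 5)"
    by (intro sum_norm_le) (simp add: nb low)
  then have "norm (\<Sum>j<K + 1. b j) \<le> real K * N ^ 5 + N ^ 5"
    by (simp add: distrib_right)
  ultimately have "N ^ 6 \<le> norm (suminf b) + 1 + (real K * N ^ 5 + N ^ 5) + N ^ 4"
    using tail unfolding nb main next1 by linarith
  moreover have "1 \<le> N ^ 5"
    using N2 by (intro one_le_power) simp
  moreover have "N ^ 4 \<le> N ^ 5"
    using N2 by (intro power_increasing) auto
  moreover have "N \<le> N ^ 5"
    using N2 by (intro self_le_power) auto
  moreover have "real K * N ^ 5 + 4 * N ^ 5 \<le> N ^ 6"
  proof -
    have "K + 4 \<le> 2 ^ 2 ^ K"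
      using assms(1)
    proof (induction K rule: dec_induct)
      case (step k)
      have "k + 4 \<le> (2 ^ 2 ^ k :: nat)" by (rule step.IH)
      moreover have "(2::nat) * 2 ^ 2 ^ k \<le> 2 ^ 2 ^ Suc k"
        using power_increasing[of "Suc (2 ^ k)" "2 ^ Suc k" "2::nat"] by simp
      ultimately show ?case by linarith
    qed simp
    then have "real (K + 4) \<le> N"
      unfolding N_def freq_def by (rule of_nat_mono)
    then have "(real K + 4) * N ^ 5 \<le> N * N ^ 5"
      using N2 by (intro mult_right_mono) auto
    then show ?thesis
      by (simp add: distrib_right flip: power_Suc)
  qed
  ultimately have "N \<le> norm (suminf b)"
    by linarith
  then show ?thesis
    by (simp add: N_def b_def[abs_def] boundary_series_def m_def)
qed

text \<open>Every real point is a limit of real points, so complex derivatives within the real line are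
  unique.\<close>

lemma has_field_derivative_unique_Reals:
  assumes "(f has_field_derivative D) (at x within \<real>)" "(f has_field_derivative E) (at x within \<real>)"
    and "x \<in> (\<real> :: complex set)"
  shows "D = E"
proof -
  have "x islimpt \<real>"
  proof (rule connected_imp_perfect[OF _ assms(3)])
    show "connected (\<real> :: complex set)"
      by (intro convex_connected) (auto simp: convex_def scaleR_conv_of_real)
    show "\<real> \<noteq> {a}" for a :: complex
      by (metis Reals_0 Reals_1 singletonD zero_neq_one)
  qed
  then have "at x within \<real> \<noteq> bot"
    by (simp add: trivial_limit_within)
  then show ?thesis
    using assms(1,2) tendsto_unique unfolding has_field_derivative_iff by blast
qed

text \<open>If the series were analytic in the angle near \<open>t\<close>, Cauchy's inequality would bound its
  derivatives of order \<open>m\<close> at \<open>t\<close> by a constant times \<open>m ^ m / \<rho> ^ m\<close>. At order \<open>2 * K + 5\<close> they are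
  at least \<open>2 ^ 2 ^ K\<close>, which grows faster.\<close>

lemma boundary_not_analytic:
  assumes "0 < r" "F holomorphic_on ball 0 r"
    and eq: "\<And>x. \<bar>x\<bar> < r \<Longrightarrow> F (of_real x) = lacunary 0 (cis (t + x))"
  shows False
proof -
  \<comment> \<open>The derivatives of \<open>F\<close> within \<open>\<real>\<close> are determined by its values on \<open>\<real>\<close>, hence agree with those of the series.\<close>
  have deriv_eq: "(deriv ^^ k) F (of_real x) = boundary_series k (of_real (t + x))" if "\<bar>x\<bar> < r" for k x
    using that
  proof (induction k arbitrary: x)
    case 0
    then show ?case by (simp add: eq lacunary_on_circle)
  next
    case (Suc k)
    let ?x = "complex_of_real x"
    have "(deriv ^^ k) F holomorphic_on ball 0 r"
      by (intro holomorphic_higher_deriv assms(2) open_ball)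
    then have "((deriv ^^ k) F has_field_derivative deriv ((deriv ^^ k) F) ?x) (at ?x)"
      using Suc.prems by (intro holomorphic_derivI[OF _ open_ball]) auto
    then have 1: "((deriv ^^ k) F has_field_derivative (deriv ^^ Suc k) F ?x) (at ?x within \<real>)"
      by (simp add: has_field_derivative_at_within)
    have "((\<lambda>w. boundary_series k (of_real t + w)) has_field_derivative
        boundary_series (Suc k) (of_real t + ?x) * 1) (at ?x within \<real>)"
    proof (rule DERIV_image_chain[where f = "boundary_series k" and g = "(+) (of_real t)", unfolded o_def])
      have im: "(+) (of_real t :: complex) ` \<real> \<subseteq> \<real>" by auto
      show "(boundary_series k has_field_derivative boundary_series (Suc k) (of_real t + ?x))
          (at (of_real t + ?x) within (+) (of_real t) ` \<real>)"
        by (rule has_field_derivative_subset[OF has_field_derivative_boundary_series im]) auto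
    qed (auto intro!: derivative_eq_intros)
    then have "((deriv ^^ k) F has_field_derivative boundary_series (Suc k) (of_real t + ?x)) (at ?x within \<real>)"
      unfolding mult_1_right
    proof (rule has_field_derivative_transform_within[where d = "r - \<bar>x\<bar>"])
      fix w :: complex assume "w \<in> \<real>" "dist w ?x < r - \<bar>x\<bar>"
      then obtain y where y: "w = of_real y" "\<bar>y - x\<bar> < r - \<bar>x\<bar>"
        by (auto elim!: Reals_cases simp: dist_norm simp flip: of_real_diff)
      then show "boundary_series k (of_real t + w) = (deriv ^^ k) F w"
        using Suc.IH[of y] by simp
    qed (use Suc.prems in auto)
    with 1 show ?case
      using has_field_derivative_unique_Reals[OF 1, of "boundary_series (Suc k) (of_real t + ?x)"]
      by simp
  qed
  define \<rho> where "\<rho> = r / 2"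
  have \<rho>: "0 < \<rho>" "\<rho> < r" using assms(1) by (auto simp: \<rho>_def)
  have cont: "continuous_on (cball 0 \<rho>) F"
    using holomorphic_on_imp_continuous_on[OF assms(2)] \<rho> by (auto elim!: continuous_on_subset)
  then have "bounded (F ` cball 0 \<rho>)"
    using compact_continuous_image compact_imp_bounded compact_cball by blast
  then obtain B where B: "B > 0" "\<And>z. z \<in> cball 0 \<rho> \<Longrightarrow> norm (F z) \<le> B"
    unfolding bounded_pos by auto
  have upper: "norm ((deriv ^^ m) F 0) \<le> fact m * B / \<rho> ^ m" for m
    by (rule Cauchy_inequality[OF _ cont \<rho>(1)])
       (use assms(2) \<rho> B in \<open>auto simp: dist_norm intro: holomorphic_on_subset\<close>)
  have fact_le: "fact m \<le> real m ^ m" for m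
    using fact_le_power[of m, where 'a = real] by simp
  have "real (freq K) \<le> B * ((2 * real K + 5) / \<rho>) ^ (2 * K + 5)" if "2 \<le> K" for K
  proof -
    have "real (freq K) \<le> norm (boundary_series (2 * K + 5) (of_real t))"
      using that by (intro norm_boundary_series_ge) auto
    also have "\<dots> = norm ((deriv ^^ (2 * K + 5)) F 0)"
      using deriv_eq[of 0 "2 * K + 5"] assms(1) by simp
    also have "\<dots> \<le> fact (2 * K + 5) * B / \<rho> ^ (2 * K + 5)"
      by (rule upper)
    also have "\<dots> \<le> real (2 * K + 5) ^ (2 * K + 5) * B / \<rho> ^ (2 * K + 5)"
      using B(1) \<rho>(1) by (intro divide_right_mono mult_right_mono fact_le) simp_all
    finally show ?thesis
      by (simp add: power_divide mult.commute[of B])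
  qed
  then have "\<forall>\<^sub>F K in sequentially. real (2 ^ 2 ^ K) \<le> B * ((2 * real K + 5) / \<rho>) ^ (2 * K + 5)"
    unfolding freq_def eventually_sequentially by blast
  moreover have "\<forall>\<^sub>F K in sequentially. B * ((2 * real K + 5) / \<rho>) powr (2 * real K + 5) < 2 powr (2 powr real K)"
    using B(1) \<rho>(1) by real_asymp
  ultimately have "\<forall>\<^sub>F K :: nat in sequentially. False"
  proof eventually_elim
    case (elim K)
    have "((2 * real K + 5) / \<rho>) powr (2 * real K + 5) = ((2 * real K + 5) / \<rho>) ^ (2 * K + 5)"
      using \<rho>(1) powr_realpow[of "(2 * real K + 5) / \<rho>" "2 * K + 5"] by simp
    moreover have "2 powr (2 powr real K) = real (2 ^ 2 ^ K)"
      using powr_realpow[of 2 "2 ^ K"] by (simp add: powr_realpow)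
    ultimately show ?case
      using elim by simp
  qed
  then show False by simp
qed

section \<open>The polydisc and iterated partial derivatives\<close>

lemma open_polydisc: "open (polydisc :: (complex ^ 'n::finite) set)"
proof -
  have "polydisc = (\<Inter>i. {z :: complex ^ 'n. norm (z $ i) < 1})"
    by (auto simp: polydisc_def)
  also have "open \<dots>"
    by (intro open_INT finite ballI open_Collect_less continuous_intros)
  finally show ?thesis .
qed

lemma zero_in_polydisc: "0 \<in> polydisc"
  by (simp add: polydisc_def)

text \<open>Brings the coordinates of boundary points into the closed disc, where the lacunary series is
  continuous.\<close>

lemma norm_nth_le_1_if_closure_polydisc:
  fixes z :: "complex ^ 'n::finite"
  assumes "z \<in> closure polydisc"
  shows "norm (z $ i) \<le> 1"
proof -
  have "closure polydisc \<subseteq> {z :: complex ^ 'n. norm (z $ i) \<le> 1}"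
    by (rule closure_minimal) (auto simp: polydisc_def less_imp_le intro!: closed_Collect_le continuous_intros)
  with assms show ?thesis by auto
qed

lemma torus_subset_closure_polydisc: "torus \<subseteq> closure polydisc"
proof
  fix z :: "complex ^ 'n" assume z: "z \<in> torus"
  have "(\<lambda>n. (1 - inverse (real (Suc n))) *\<^sub>R z) \<longlonglongrightarrow> (1 - 0) *\<^sub>R z"
    by (intro tendsto_intros LIMSEQ_inverse_real_of_nat)
  moreover have "(1 - inverse (real (Suc n))) *\<^sub>R z \<in> polydisc" for n
    using z by (auto simp: polydisc_def torus_def field_simps)
  ultimately show "z \<in> closure polydisc"
    unfolding closure_sequential by (intro exI conjI allI) auto
qed

lemma axis_zero: "axis i 0 = 0"
  by simp

lemma bounded_linear_axis: "bounded_linear (axis i :: complex \<Rightarrow> complex ^ 'n::finite)"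
proof (rule bounded_linear_intro[where K = 1])
  fix x y :: complex and r :: real
  show "axis i (x + y) = axis i x + (axis i y :: complex ^ 'n)"
    by (simp add: vec_eq_iff axis_def)
  show "axis i (r *\<^sub>R x) = r *\<^sub>R (axis i x :: complex ^ 'n)"
    by (simp add: vec_eq_iff axis_def)
  have "norm (axis i x :: complex ^ 'n) = sqrt (\<Sum>j\<in>UNIV. if j = i then (norm x)\<^sup>2 else 0)"
    unfolding norm_vec_def L2_set_def by (intro arg_cong[of _ _ sqrt] sum.cong) (auto simp: axis_def)
  then show "norm (axis i x :: complex ^ 'n) \<le> norm x * 1"
    by simp
qed

lemma partial_deriv_cong:
  assumes "open S" "\<And>z. z \<in> S \<Longrightarrow> f z = g z" "z \<in> S"
  shows "partial_deriv i f z = partial_deriv i g z"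
  unfolding partial_deriv_def
proof (rule deriv_cong_ev[OF _ refl])
  have "((\<lambda>w. z + axis i w) \<longlongrightarrow> z + axis i 0) (nhds 0)"
    by (intro tendsto_add tendsto_const bounded_linear.tendsto[OF bounded_linear_axis] filterlim_ident)
  then have "((\<lambda>w. z + axis i w) \<longlongrightarrow> z) (nhds 0)"
    by (simp add: axis_zero)
  then have "\<forall>\<^sub>F w in nhds 0. z + axis i w \<in> S"
    using assms by (simp add: topological_tendstoD)
  then show "\<forall>\<^sub>F w in nhds 0. f (z + axis i w) = g (z + axis i w)"
    by eventually_elim (rule assms(2))
qed

lemma partial_deriv_funpow_cong:
  assumes "open S" "\<And>z. z \<in> S \<Longrightarrow> f z = g z" "z \<in> S"
  shows "(partial_deriv i ^^ k) f z = (partial_deriv i ^^ k) g z"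
  using assms(3)
proof (induction k arbitrary: z)
  case (Suc k)
  then show ?case
    using partial_deriv_cong[OF assms(1), of "(partial_deriv i ^^ k) f" "(partial_deriv i ^^ k) g"] by simp
qed (use assms(2) in auto)

lemma foldr_partial_deriv_cong:
  assumes "open S" "\<And>z. z \<in> S \<Longrightarrow> f z = g z" "z \<in> S"
  shows "foldr (\<lambda>i. partial_deriv i ^^ \<alpha> i) xs f z = foldr (\<lambda>i. partial_deriv i ^^ \<alpha> i) xs g z"
  using assms(3)
proof (induction xs arbitrary: z)
  case (Cons i xs)
  then show ?case
    using partial_deriv_funpow_cong[OF assms(1) Cons.IH] by simp
qed (use assms(2) in auto)

lemma multi_deriv_cong:
  assumes "\<And>z. z \<in> polydisc \<Longrightarrow> f z = g z" "z \<in> polydisc"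
  shows "multi_deriv \<alpha> f z = multi_deriv \<alpha> g z"
  unfolding multi_deriv_def by (rule foldr_partial_deriv_cong[OF open_polydisc assms])

lemma multi_deriv_0:
  fixes f :: "complex ^ 'n::finite \<Rightarrow> complex"
  shows "multi_deriv (\<lambda>_. 0) f = f"
proof -
  have "foldr (\<lambda>i. partial_deriv i ^^ 0) xs f = f" for xs :: "'n list"
    by (induction xs) auto
  then show ?thesis by (simp add: multi_deriv_def)
qed

lemma zero_in_mindices: "(\<lambda>_. 0) \<in> mindices p"
  by (simp add: mindices_def flip: zero_enat_def)

text \<open>Unconditional, because shifts of the argument commute with \<open>deriv\<close> even where it is a
  default value. It reduces repeated derivatives in one direction to functions of one variable.\<close>

lemma partial_deriv_funpow_eq_slice:
  fixes f :: "complex ^ 'n::finite \<Rightarrow> complex"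
  shows "(partial_deriv i ^^ k) f z = (deriv ^^ k) (\<lambda>w. f (z + axis i (w - z $ i))) (z $ i)"
proof (induction k arbitrary: z)
  case 0
  then show ?case by (simp add: axis_zero)
next
  case (Suc k)
  have *: "z + axis i w + axis i (v - (z $ i + w)) = z + axis i (v - z $ i)" for v w
    by (simp add: vec_eq_iff axis_def)
  have nth: "(z + axis i w) $ i = z $ i + w" for w
    by (simp add: axis_def)
  have "(partial_deriv i ^^ Suc k) f z = deriv (\<lambda>w. (partial_deriv i ^^ k) f (z + axis i w)) 0"
    by (simp add: partial_deriv_def)
  also have "\<dots> = deriv ((deriv ^^ k) (\<lambda>v. f (z + axis i (v - z $ i))) \<circ> (\<lambda>w. z $ i + w)) 0"
    by (simp add: Suc.IH * nth o_def)
  also have "\<dots> = (deriv ^^ Suc k) (\<lambda>w. f (z + axis i (w - z $ i))) (z $ i)"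
    by (simp add: deriv_shift_0[of _ "z $ i"])
  finally show ?case .
qed

lemma holomorphic_slice:
  fixes z :: "complex ^ 'n::finite"
  assumes f: "mholomorphic_on f polydisc" and z: "z \<in> polydisc"
  shows "(\<lambda>w. f (z + axis i (w - z $ i))) holomorphic_on ball 0 1"
proof (rule holomorphic_onI)
  fix w :: complex assume w: "w \<in> ball 0 1"
  let ?e = "\<lambda>w. z + axis i (w - z $ i)"
  have "?e w \<in> polydisc"
    using w z by (auto simp: polydisc_def axis_def)
  then obtain L where L: "(f has_derivative L) (at (?e w))" "\<And>c v. L (c *s v) = c * L v"
    using f unfolding mholomorphic_on_def by blast
  have "((\<lambda>w. w - z $ i) has_derivative (\<lambda>h. h)) (at w)"
    by (auto intro!: derivative_eq_intros)
  then have "(?e has_derivative (\<lambda>h. axis i h)) (at w)"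
    by (auto intro!: derivative_eq_intros bounded_linear.has_derivative[OF bounded_linear_axis])
  from has_derivative_compose[OF this L(1)]
  have "((\<lambda>w. f (?e w)) has_derivative (\<lambda>h. L (axis i h))) (at w)" .
  moreover have "(\<lambda>h. L (axis i h)) = (*) (L (axis i 1))"
  proof
    fix h :: complex
    have "axis i h = h *s axis i 1"
      by (simp add: vec_eq_iff axis_def)
    then show "L (axis i h) = L (axis i 1) * h"
      by (simp only: L(2) mult.commute)
  qed
  ultimately have "((\<lambda>w. f (?e w)) has_field_derivative L (axis i 1)) (at w)"
    by (simp only: has_field_derivative_def)
  then show "(\<lambda>w. f (?e w)) field_differentiable at w within ball 0 1"
    by (meson field_differentiable_at_within field_differentiable_def)
qed

lemma partial_deriv_funpow_add_lacunary:
  assumes f: "mholomorphic_on f polydisc" and z: "z \<in> polydisc"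
  shows "(partial_deriv i ^^ k) (\<lambda>z. f z + c * lacunary 0 (z $ i)) z =
    (partial_deriv i ^^ k) f z + c * lacunary k (z $ i)"
proof -
  have zi: "z $ i \<in> ball 0 1"
    using z by (simp add: polydisc_def)
  have "(deriv ^^ k) (\<lambda>w. f (z + axis i (w - z $ i)) + c * lacunary 0 w) (z $ i) =
      (deriv ^^ k) (\<lambda>w. f (z + axis i (w - z $ i))) (z $ i) + (deriv ^^ k) (\<lambda>w. c * lacunary 0 w) (z $ i)"
    by (intro higher_deriv_add[OF holomorphic_slice[OF f z] _ open_ball zi] holomorphic_intros holomorphic_lacunary)
  also have "(deriv ^^ k) (\<lambda>w. c * lacunary 0 w) (z $ i) = c * lacunary k (z $ i)"
    by (simp only: higher_deriv_cmult[OF holomorphic_lacunary zi open_ball] higher_deriv_lacunary[OF zi])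
  moreover have "(z + axis i (w - z $ i)) $ i = w" for w
    by (simp add: axis_def)
  ultimately show ?thesis
    by (simp add: partial_deriv_funpow_eq_slice)
qed

text \<open>Along direction \<open>j\<close> the second summand is constant, and adding a constant does not change which
  numbers are derivatives. Hence the equation holds also where \<open>f\<close> has no partial derivative and
  \<open>deriv\<close> is a default value.\<close>

lemma partial_deriv_add_other_coordinate:
  assumes "i \<noteq> j"
  shows "partial_deriv j (\<lambda>z. f z + q (z $ i)) = partial_deriv j f"
proof
  fix z
  have "((\<lambda>w. f (z + axis j w) + q (z $ i)) has_field_derivative D) (at 0) \<longleftrightarrow>
      ((\<lambda>w. f (z + axis j w)) has_field_derivative D) (at 0)" for D
    by (simp add: has_field_derivative_iff)
  moreover have "(z + axis j w) $ i = z $ i" for w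
    using assms by (simp add: axis_def)
  ultimately show "partial_deriv j (\<lambda>z. f z + q (z $ i)) z = partial_deriv j f z"
    by (simp add: partial_deriv_def deriv_def)
qed

lemma foldr_partial_deriv_add_other_coordinate:
  assumes "i \<notin> set xs"
  shows "foldr (\<lambda>j. partial_deriv j ^^ \<alpha> j) xs (\<lambda>z. f z + q (z $ i)) =
    (\<lambda>z. foldr (\<lambda>j. partial_deriv j ^^ \<alpha> j) xs f z + (if \<forall>j\<in>set xs. \<alpha> j = 0 then q (z $ i) else 0))"
  using assms
proof (induction xs)
  case (Cons j xs)
  have pow: "(partial_deriv j ^^ k) (\<lambda>z. g z + q (z $ i)) =
      (\<lambda>z. (partial_deriv j ^^ k) g z + (if k = 0 then q (z $ i) else 0))" for k g q
  proof (induction k arbitrary: g)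
    case (Suc k)
    have "(partial_deriv j ^^ Suc k) (\<lambda>z. g z + q (z $ i)) =
        partial_deriv j (\<lambda>z. (partial_deriv j ^^ k) g z + (if k = 0 then q else (\<lambda>_. 0)) (z $ i))"
      by (simp add: Suc.IH)
    also have "\<dots> = partial_deriv j ((partial_deriv j ^^ k) g)"
      by (rule partial_deriv_add_other_coordinate) (use Cons.prems in auto)
    finally show ?case by simp
  qed simp
  define q' where "q' w = (if \<forall>j\<in>set xs. \<alpha> j = 0 then q w else 0)" for w
  have "foldr (\<lambda>j. partial_deriv j ^^ \<alpha> j) xs (\<lambda>z. f z + q (z $ i)) =
    (\<lambda>z. foldr (\<lambda>j. partial_deriv j ^^ \<alpha> j) xs f z + q' (z $ i))"
    unfolding q'_def using Cons.IH Cons.prems by simp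
  then have "foldr (\<lambda>j. partial_deriv j ^^ \<alpha> j) (j # xs) (\<lambda>z. f z + q (z $ i)) =
    (\<lambda>z. foldr (\<lambda>j. partial_deriv j ^^ \<alpha> j) (j # xs) f z + (if \<alpha> j = 0 then q' (z $ i) else 0))"
    by (simp add: pow)
  moreover have "(if \<alpha> j = 0 then q' w else 0) = (if \<forall>j\<in>set (j # xs). \<alpha> j = 0 then q w else 0)" for w
    by (simp add: q'_def)
  ultimately show ?case
    by (simp only:)
qed simp

section \<open>Perturbation by the lacunary series in one coordinate\<close>

text \<open>The last entry of the enumeration is the coordinate with respect to which \<open>multi_deriv\<close>
  differentiates first. Perturbations depend on this coordinate only. Their derivatives then
  enter while the other summand is still a holomorphic function of one variable; in all later
  directions the perturbation is constant. So \<open>multi_deriv\<close> is additive on such sums without any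
  information on the mixed derivatives of the other summand.\<close>

definition slot :: "'n::finite" where
  "slot = last index_list"

lemma index_list_split:
  obtains xs :: "'n::finite list" where "index_list = xs @ [slot]" "slot \<notin> set xs"
proof -
  have "(index_list :: 'n list) \<noteq> []"
    using index_list(2)[where 'n = 'n] by auto
  then have "index_list = butlast index_list @ [slot :: 'n]"
    by (simp add: slot_def)
  then show thesis
    using index_list(1)[where 'n = 'n] that by (metis distinct.simps(2) distinct_append not_distinct_conv_prefix append.right_neutral)
qed

text \<open>The mixed derivative of order \<open>\<alpha>\<close> of \<open>\<lambda>z. lacunary 0 (z $ slot)\<close>, as a function of the
  coordinate \<open>slot\<close>.\<close>

definition slot_deriv :: "('n::finite \<Rightarrow> nat) \<Rightarrow> complex \<Rightarrow> complex" where
  "slot_deriv \<alpha> w = (if \<forall>j. j \<noteq> slot \<longrightarrow> \<alpha> j = 0 then lacunary (\<alpha> slot) w else 0)"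

lemma multi_deriv_add_lacunary:
  fixes f :: "complex ^ 'n::finite \<Rightarrow> complex"
  assumes f: "mholomorphic_on f polydisc" and z: "z \<in> polydisc"
  shows "multi_deriv \<alpha> (\<lambda>z. f z + c * lacunary 0 (z $ slot)) z = multi_deriv \<alpha> f z + c * slot_deriv \<alpha> (z $ slot)"
proof -
  obtain xs :: "'n list" where xs: "index_list = xs @ [slot]" "slot \<notin> set xs"
    by (rule index_list_split)
  have "insert slot (set xs) = UNIV"
    using index_list(2)[where 'n = 'n] unfolding xs(1) by simp
  then have "set xs = UNIV - {slot}"
    using xs(2) by blast
  then have set_xs: "(\<forall>j\<in>set xs. \<alpha> j = 0) \<longleftrightarrow> (\<forall>j. j \<noteq> slot \<longrightarrow> \<alpha> j = 0)"
    by auto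
  let ?D = "foldr (\<lambda>i. partial_deriv i ^^ \<alpha> i) xs"
  have "multi_deriv \<alpha> (\<lambda>z. f z + c * lacunary 0 (z $ slot)) z =
      ?D ((partial_deriv slot ^^ \<alpha> slot) (\<lambda>z. f z + c * lacunary 0 (z $ slot))) z"
    by (simp add: multi_deriv_def xs)
  also have "\<dots> = ?D (\<lambda>z. (partial_deriv slot ^^ \<alpha> slot) f z + c * lacunary (\<alpha> slot) (z $ slot)) z"
    by (intro foldr_partial_deriv_cong[OF open_polydisc _ z] partial_deriv_funpow_add_lacunary[OF f])
  also have "\<dots> = ?D ((partial_deriv slot ^^ \<alpha> slot) f) z +
      (if \<forall>j\<in>set xs. \<alpha> j = 0 then c * lacunary (\<alpha> slot) (z $ slot) else 0)"
    by (simp only: foldr_partial_deriv_add_other_coordinate[OF xs(2), of \<alpha> _ "\<lambda>w. c * lacunary (\<alpha> slot) w"])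
  also have "(if \<forall>j\<in>set xs. \<alpha> j = 0 then c * lacunary (\<alpha> slot) (z $ slot) else 0) = c * slot_deriv \<alpha> (z $ slot)"
    unfolding slot_deriv_def set_xs by (simp only: if_distrib[of "(*) c"] mult_zero_right)
  finally show ?thesis
    by (simp add: multi_deriv_def xs)
qed

lemma continuous_on_slot_deriv: "continuous_on (cball 0 1) (slot_deriv \<alpha>)"
proof -
  have "slot_deriv \<alpha> = lacunary (\<alpha> slot) \<or> slot_deriv \<alpha> = (\<lambda>_. 0)"
    by (cases "\<forall>j. j \<noteq> slot \<longrightarrow> \<alpha> j = 0") (auto simp: slot_deriv_def fun_eq_iff)
  then show ?thesis
    using continuous_on_lacunary[of "\<alpha> slot"] by auto
qed

lemma slot_deriv_bounded:
  obtains B where "0 < B" "\<And>w. norm w \<le> 1 \<Longrightarrow> norm (slot_deriv \<alpha> w) \<le> B"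
proof -
  have "bounded (slot_deriv \<alpha> ` cball 0 1)"
    using compact_continuous_image[OF continuous_on_slot_deriv compact_cball] compact_imp_bounded by blast
  then show thesis
    using that unfolding bounded_pos by auto
qed

lemma mholomorphic_on_cong:
  assumes "open S" "\<And>z. z \<in> S \<Longrightarrow> f z = g z" "mholomorphic_on f S"
  shows "mholomorphic_on g S"
  using assms(2,3) has_derivative_transform_within_open[OF _ assms(1)] unfolding mholomorphic_on_def by meson

lemma mholomorphic_on_diff:
  assumes "mholomorphic_on f S" "mholomorphic_on g S"
  shows "mholomorphic_on (\<lambda>z. f z - g z) S"
  unfolding mholomorphic_on_def
proof
  fix z assume "z \<in> S"
  with assms obtain L M where "(f has_derivative L) (at z)" "(g has_derivative M) (at z)"
    "\<And>c v. L (c *s v) = c * L v" "\<And>c v. M (c *s v) = c * M v"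
    unfolding mholomorphic_on_def by meson
  then show "\<exists>L. ((\<lambda>z. f z - g z) has_derivative L) (at z) \<and> (\<forall>c v. L (c *s v) = c * L v)"
    by (intro exI[of _ "\<lambda>v. L v - M v"]) (auto intro!: has_derivative_diff simp: algebra_simps)
qed

lemma mholomorphic_on_add_lacunary:
  assumes "mholomorphic_on f polydisc"
  shows "mholomorphic_on (\<lambda>z. f z + c * lacunary 0 (z $ i)) polydisc"
  unfolding mholomorphic_on_def
proof
  fix z :: "complex ^ 'a" assume z: "z \<in> polydisc"
  with assms obtain L where L: "(f has_derivative L) (at z)" "\<And>c v. L (c *s v) = c * L v"
    unfolding mholomorphic_on_def by blast
  have "(lacunary 0 has_derivative (*) (lacunary 1 (z $ i))) (at (z $ i))"
    using has_field_derivative_lacunary[of "z $ i" 0] z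
    by (simp add: polydisc_def has_field_derivative_def)
  moreover have "((\<lambda>z :: complex ^ 'a. z $ i) has_derivative (\<lambda>v. v $ i)) (at z)"
    by (intro bounded_linear.has_derivative[OF bounded_linear_vec_nth] has_derivative_ident)
  ultimately have "((\<lambda>z :: complex ^ 'a. lacunary 0 (z $ i)) has_derivative (\<lambda>v. lacunary 1 (z $ i) * v $ i)) (at z)"
    by (rule has_derivative_compose[rotated])
  then have "((\<lambda>z. f z + c * lacunary 0 (z $ i)) has_derivative
      (\<lambda>v. L v + c * (lacunary 1 (z $ i) * v $ i))) (at z)"
    by (intro has_derivative_add L has_derivative_mult_right)
  then show "\<exists>L. ((\<lambda>z. f z + c * lacunary 0 (z $ i)) has_derivative L) (at z) \<and> (\<forall>c v. L (c *s v) = c * L v)"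
    by (intro exI conjI) (auto simp: L algebra_simps)
qed

definition perturb :: "complex \<Rightarrow> (complex ^ 'n::finite \<Rightarrow> complex) \<Rightarrow> complex ^ 'n \<Rightarrow> complex" where
  "perturb c f = restrict (\<lambda>z. f z + c * lacunary 0 (z $ slot)) polydisc"

lemma continuous_on_slot_deriv_nth:
  "continuous_on (closure polydisc) (\<lambda>z :: complex ^ 'n::finite. slot_deriv \<alpha> (z $ slot))"
  by (rule continuous_on_compose2[OF continuous_on_slot_deriv])
     (auto intro!: continuous_intros norm_nth_le_1_if_closure_polydisc)

text \<open>All derivatives of the lacunary series are continuous on the closed disc, so one perturbation
  serves every \<open>p\<close>, including \<open>\<infinity>\<close>.\<close>

lemma perturb_in_Ap:
  assumes f: "f \<in> Ap p"
  shows "perturb c f \<in> Ap p"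
proof -
  have hol: "mholomorphic_on f polydisc"
    using f by (simp add: Ap_def)
  have "mholomorphic_on (perturb c f) polydisc"
    by (rule mholomorphic_on_cong[OF open_polydisc _ mholomorphic_on_add_lacunary[OF hol]])
       (simp add: perturb_def)
  moreover have "\<exists>g. extends_to_closure (multi_deriv \<alpha> (perturb c f)) g" if \<alpha>: "\<alpha> \<in> mindices p" for \<alpha>
  proof -
    obtain g where "extends_to_closure (multi_deriv \<alpha> f) g"
      using f \<alpha> by (auto simp: Ap_def)
    then have g: "continuous_on (closure polydisc) g" "\<And>z. z \<in> polydisc \<Longrightarrow> g z = multi_deriv \<alpha> f z"
      by (simp_all add: extends_to_closure_def)
    have "multi_deriv \<alpha> (perturb c f) z = multi_deriv \<alpha> f z + c * slot_deriv \<alpha> (z $ slot)"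
      if "z \<in> polydisc" for z
    proof -
      have "multi_deriv \<alpha> (perturb c f) z = multi_deriv \<alpha> (\<lambda>z. f z + c * lacunary 0 (z $ slot)) z"
        using that by (intro multi_deriv_cong) (simp_all add: perturb_def)
      then show ?thesis by (simp add: multi_deriv_add_lacunary[OF hol that])
    qed
    then have "extends_to_closure (multi_deriv \<alpha> (perturb c f)) (\<lambda>z. g z + c * slot_deriv \<alpha> (z $ slot))"
      unfolding extends_to_closure_def
      by (auto intro!: continuous_intros g continuous_on_slot_deriv_nth)
    then show ?thesis by blast
  qed
  ultimately show ?thesis
    by (simp add: Ap_def perturb_def)
qed

text \<open>Functions at bounded distance are bounded above together, and all suprema of sets of reals that
  are unbounded above have the same default value. So the inequality persists in the unbounded case.
  This matters because it is applied to \<open>multi_deriv \<alpha> (\<lambda>z. f z - g z)\<close>, whose boundedness would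
  follow only after exchanging mixed derivatives with differences.\<close>

lemma SUP_le_SUP_add:
  fixes u v :: "'a \<Rightarrow> real"
  assumes "A \<noteq> {}" and close: "\<And>x. x \<in> A \<Longrightarrow> \<bar>u x - v x\<bar> \<le> K"
  shows "(SUP x\<in>A. u x) \<le> (SUP x\<in>A. v x) + K"
proof (cases "bdd_above (v ` A)")
  case True
  show ?thesis
  proof (rule cSUP_least[OF assms(1)])
    fix x assume "x \<in> A"
    then have "v x \<le> (SUP x\<in>A. v x)"
      by (rule cSUP_upper[OF _ True])
    with close[OF \<open>x \<in> A\<close>] show "u x \<le> (SUP x\<in>A. v x) + K"
      by linarith
  qed
next
  case False
  have "\<not> bdd_above (u ` A)"
  proof
    assume "bdd_above (u ` A)"
    then obtain M where M: "\<And>x. x \<in> A \<Longrightarrow> u x \<le> M"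
      by (auto simp: bdd_above_def)
    have "v x \<le> M + K" if "x \<in> A" for x
      using M[OF that] close[OF that] by linarith
    with False show False
      by (auto simp: bdd_above_def)
  qed
  then have "(\<forall>y\<in>u ` A. y \<le> z) = (\<forall>y\<in>v ` A. y \<le> z)" for z
    using False bdd_above.I by metis
  then have "(SUP x\<in>A. u x) = (SUP x\<in>A. v x)"
    by (simp only: Sup_real_def)
  moreover have "0 \<le> K"
    using assms by fastforce
  ultimately show ?thesis by simp
qed

lemma Ap_seminorm_perturb_le:
  assumes "mholomorphic_on f polydisc" "mholomorphic_on g polydisc"
    and B: "\<And>w. norm w \<le> 1 \<Longrightarrow> norm (slot_deriv \<alpha> w) \<le> B"
  shows "Ap_seminorm \<alpha> (\<lambda>z. perturb c f z - g z) \<le> Ap_seminorm \<alpha> (\<lambda>z. f z - g z) + norm c * B"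
  unfolding Ap_seminorm_def
proof (rule SUP_le_SUP_add)
  show "(polydisc :: (complex ^ 'a) set) \<noteq> {}"
    using zero_in_polydisc by blast
  fix z :: "complex ^ 'a" assume z: "z \<in> polydisc"
  have "multi_deriv \<alpha> (\<lambda>z. perturb c f z - g z) z =
      multi_deriv \<alpha> (\<lambda>z. (f z - g z) + c * lacunary 0 (z $ slot)) z"
    using z by (intro multi_deriv_cong) (simp_all add: perturb_def)
  also have "\<dots> = multi_deriv \<alpha> (\<lambda>z. f z - g z) z + c * slot_deriv \<alpha> (z $ slot)"
    by (rule multi_deriv_add_lacunary[OF mholomorphic_on_diff[OF assms(1,2)] z])
  finally have eq: "multi_deriv \<alpha> (\<lambda>z. perturb c f z - g z) z =
    multi_deriv \<alpha> (\<lambda>z. f z - g z) z + c * slot_deriv \<alpha> (z $ slot)" .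
  have "norm (c * slot_deriv \<alpha> (z $ slot)) \<le> norm c * B"
    using z by (auto simp: norm_mult polydisc_def less_imp_le intro!: mult_left_mono B)
  then show "\<bar>norm (multi_deriv \<alpha> (\<lambda>z. perturb c f z - g z) z) - norm (multi_deriv \<alpha> (\<lambda>z. f z - g z) z)\<bar> \<le> norm c * B"
    using norm_triangle_ineq3[of "multi_deriv \<alpha> (\<lambda>z. f z - g z) z + c * slot_deriv \<alpha> (z $ slot)" "multi_deriv \<alpha> (\<lambda>z. f z - g z) z"]
    by (simp add: eq)
qed

text \<open>On a subbasic set this is the previous estimate: \<open>perturb c f\<close> moves each seminorm distance by
  at most a multiple of the norm of \<open>c\<close>.\<close>

lemma openin_Ap_topology_perturb:
  assumes "openin (Ap_topology p) U" "f \<in> U"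
  shows "\<exists>\<epsilon>>0. \<forall>c. norm c < \<epsilon> \<longrightarrow> perturb c f \<in> U"
proof -
  have "f \<in> Ap p"
    using assms openin_subset topspace_Ap_topology by blast
  then have hol: "mholomorphic_on f polydisc"
    by (simp add: Ap_def)
  have "generate_topology_on {{g \<in> Ap p. Ap_seminorm \<alpha> (\<lambda>z. g z - f z) < \<epsilon>} | f \<alpha> \<epsilon>.
      f \<in> Ap p \<and> \<alpha> \<in> mindices p \<and> 0 < \<epsilon>} U"
    using assms(1) by (simp add: Ap_topology_def openin_topology_generated_by_iff)
  then show ?thesis
    using assms(2)
  proof induction
    case (Int U V)
    then obtain \<epsilon> \<epsilon>' where "\<epsilon> > 0" "\<epsilon>' > 0" "\<And>c. norm c < \<epsilon> \<Longrightarrow> perturb c f \<in> U" "\<And>c. norm c < \<epsilon>' \<Longrightarrow> perturb c f \<in> V"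
      by auto
    then show ?case
      by (intro exI[of _ "min \<epsilon> \<epsilon>'"]) auto
  next
    case (UN K)
    then obtain k where k: "k \<in> K" "f \<in> k" by blast
    from UN.IH[OF k] k show ?case by blast
  next
    case (Basis s)
    then obtain g \<alpha> \<epsilon> where s: "s = {h \<in> Ap p. Ap_seminorm \<alpha> (\<lambda>z. h z - g z) < \<epsilon>}" and g: "g \<in> Ap p"
      by blast
    obtain B where B: "B > 0" "\<And>w. norm w \<le> 1 \<Longrightarrow> norm (slot_deriv \<alpha> w) \<le> B"
      using slot_deriv_bounded by blast
    define \<eta> where "\<eta> = (\<epsilon> - Ap_seminorm \<alpha> (\<lambda>z. f z - g z)) / B"
    have "\<eta> > 0"
      using Basis.prems B(1) by (simp add: \<eta>_def s)
    moreover have "perturb c f \<in> s" if "norm c < \<eta>" for c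
    proof -
      have "Ap_seminorm \<alpha> (\<lambda>z. perturb c f z - g z) \<le> Ap_seminorm \<alpha> (\<lambda>z. f z - g z) + norm c * B"
        using g by (intro Ap_seminorm_perturb_le hol B(2)) (auto simp: Ap_def)
      also have "\<dots> < \<epsilon>"
        using that B(1) by (simp add: \<eta>_def field_simps)
      finally show ?thesis
        using perturb_in_Ap[OF \<open>f \<in> Ap p\<close>] by (simp add: s)
    qed
    ultimately show ?case by blast
  qed simp
qed

lemma extends_to_closure_cont_extension:
  assumes "f \<in> Ap p"
  shows "extends_to_closure f (cont_extension f)"
proof -
  have "\<exists>g. extends_to_closure f g"
    using assms zero_in_mindices[of p] multi_deriv_0[of f] unfolding Ap_def by force
  then show ?thesis
    unfolding cont_extension_def by (rule someI_ex)
qed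

text \<open>With \<open>b = 0\<close> this is the uniqueness of continuous extensions.\<close>

lemma norm_cont_extension_diff_le:
  assumes "extends_to_closure f F" "extends_to_closure g G"
    and "\<And>z. z \<in> polydisc \<Longrightarrow> norm (f z - g z) \<le> b" "z \<in> closure polydisc"
  shows "norm (F z - G z) \<le> b"
  by (rule continuous_on_closure_norm_le[of polydisc "\<lambda>z. F z - G z"])
     (use assms in \<open>auto simp: extends_to_closure_def intro!: continuous_intros\<close>)

lemma cont_extension_perturb:
  assumes "f \<in> Ap p" "z \<in> closure polydisc"
  shows "cont_extension (perturb c f) z = cont_extension f z + c * lacunary 0 (z $ slot)"
proof -
  have ext: "extends_to_closure f (cont_extension f)"
    using assms(1) by (rule extends_to_closure_cont_extension)
  have "continuous_on (closure polydisc) (\<lambda>z :: complex ^ 'a. lacunary 0 (z $ slot))"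
    using continuous_on_slot_deriv_nth[of "\<lambda>_. 0"] by (simp add: slot_deriv_def)
  then have "extends_to_closure (perturb c f) (\<lambda>z. cont_extension f z + c * lacunary 0 (z $ slot))"
    using ext by (auto simp: extends_to_closure_def perturb_def intro!: continuous_intros)
  with norm_cont_extension_diff_le[OF extends_to_closure_cont_extension[OF perturb_in_Ap[OF assms(1)]] _ _ assms(2), where b = 0]
  show ?thesis by fastforce
qed

section \<open>Real analyticity through compact families of power series\<close>

text \<open>Writing points near \<open>\<zeta>\<close> on the torus as \<open>rotate_by \<zeta> s\<close> makes the angles of \<open>\<zeta>\<close> disappear. The
  coefficients are normalised by a single number \<open>m\<close> so that they form a compact product of discs,
  and the cube has half the side at which convergence could fail, which leaves the majorant
  \<open>m * (\<Prod>i. (1 / 2) ^ k i)\<close> for all of them at once.\<close>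

definition bounded_coeffs :: "nat \<Rightarrow> (('n::finite \<Rightarrow> nat) \<Rightarrow> complex) set" where
  "bounded_coeffs m = PiE UNIV (\<lambda>k. cball 0 (real m ^ Suc (\<Sum>i\<in>UNIV. k i)))"

definition small_cube :: "nat \<Rightarrow> (real ^ 'n::finite) set" where
  "small_cube m = {s. \<forall>i. \<bar>s $ i\<bar> \<le> 1 / (2 * real m)}"

definition power_series :: "(('n::finite \<Rightarrow> nat) \<Rightarrow> complex) \<Rightarrow> real ^ 'n \<Rightarrow> complex" where
  "power_series a s = (\<Sum>\<^sub>\<infinity>k. mpower_term a 0 s k)"

definition rotate_by :: "complex ^ 'n \<Rightarrow> real ^ 'n \<Rightarrow> complex ^ 'n::finite" where
  "rotate_by \<zeta> s = (\<chi> i. \<zeta> $ i * cis (s $ i))"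

definition has_chart :: "nat \<Rightarrow> (complex ^ 'n::finite \<Rightarrow> complex) \<Rightarrow> complex ^ 'n \<Rightarrow> (('n \<Rightarrow> nat) \<Rightarrow> complex) \<Rightarrow> bool" where
  "has_chart m g \<zeta> a \<longleftrightarrow> (\<forall>s\<in>small_cube m. power_series a s = g (rotate_by \<zeta> s))"

lemma summable_on_prod_half: "(\<lambda>k :: 'n::finite \<Rightarrow> nat. \<Prod>i\<in>UNIV. (1 / 2 :: real) ^ k i) summable_on UNIV"
proof -
  have "Infinite_Set_Sum.abs_summable_on (\<lambda>n. (1 / 2 :: real) ^ n) UNIV"
    by (simp add: abs_summable_on_nat_iff' summable_geometric)
  then have "Infinite_Set_Sum.abs_summable_on (\<lambda>k. \<Prod>i\<in>UNIV. (1 / 2 :: real) ^ k i) (PiE (UNIV :: 'n set) (\<lambda>_. UNIV))"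
    by (intro abs_summable_on_prod_PiE) auto
  then have "(\<lambda>k :: 'n \<Rightarrow> nat. norm (\<Prod>i\<in>UNIV. (1 / 2 :: real) ^ k i)) summable_on UNIV"
    unfolding abs_summable_equivalent[symmetric] by simp
  then show ?thesis
    by (simp add: prod_nonneg abs_prod)
qed

text \<open>Stated for complex arguments since it also gives the holomorphic extension of a power series
  in one of its variables.\<close>

lemma norm_coeff_times_prod_le:
  fixes v :: "'n::finite \<Rightarrow> complex"
  assumes "0 < m" "a \<in> bounded_coeffs m" "\<And>i. norm (v i) \<le> 1 / (2 * real m)"
  shows "norm (a k * (\<Prod>i\<in>UNIV. v i ^ k i)) \<le> real m * (\<Prod>i\<in>UNIV. (1 / 2) ^ k i)"
proof -
  have "norm (a k) \<le> real m ^ Suc (\<Sum>i\<in>UNIV. k i)"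
    using assms(2) by (auto simp: bounded_coeffs_def PiE_iff)
  moreover have "norm (\<Prod>i\<in>UNIV. v i ^ k i) \<le> (\<Prod>i\<in>UNIV. (1 / (2 * real m)) ^ k i)"
    unfolding prod_norm[symmetric] norm_power using assms(3) by (intro prod_mono conjI power_mono) auto
  ultimately have "norm (a k * (\<Prod>i\<in>UNIV. v i ^ k i))
      \<le> real m ^ Suc (\<Sum>i\<in>UNIV. k i) * (\<Prod>i\<in>UNIV. (1 / (2 * real m)) ^ k i)"
    unfolding norm_mult by (intro mult_mono) auto
  also have "\<dots> = real m * (\<Prod>i\<in>UNIV. real m ^ k i * (1 / (2 * real m)) ^ k i)"
    by (simp add: power_sum prod.distrib)
  also have "\<dots> = real m * (\<Prod>i\<in>UNIV. (1 / 2) ^ k i)"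
    using assms(1) by (simp flip: power_mult_distrib)
  finally show ?thesis .
qed

lemma norm_mpower_term_le:
  assumes "0 < m" "a \<in> bounded_coeffs m" "s \<in> small_cube m"
  shows "norm (mpower_term a 0 s k) \<le> real m * (\<Prod>i\<in>UNIV. (1 / 2) ^ k i)"
  using norm_coeff_times_prod_le[OF assms(1,2), of "\<lambda>i. of_real (s $ i)" k] assms(3)
  by (simp add: mpower_term_def small_cube_def)

lemma summable_on_majorant: "(\<lambda>k :: 'n::finite \<Rightarrow> nat. real m * (\<Prod>i\<in>UNIV. (1 / 2) ^ k i)) summable_on UNIV"
  by (intro summable_on_cmult_right summable_on_prod_half)

lemma mpower_term_shift: "mpower_term a \<theta> t k = mpower_term a 0 (t - \<theta>) k"
  by (simp add: mpower_term_def)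

text \<open>Summability at the corner of the cube bounds the coefficients geometrically, which gives the
  bound by \<open>m\<close>. Conversely, the geometric majorant gives absolute and uniform convergence.\<close>

lemma real_analytic_at_iff_has_chart:
  fixes g :: "complex ^ 'n::finite \<Rightarrow> complex"
  assumes \<zeta>: "\<zeta> \<in> torus"
  shows "real_analytic_at g \<zeta> \<longleftrightarrow> (\<exists>m>0. \<exists>a\<in>bounded_coeffs m. has_chart m g \<zeta> a)"
proof
  assume "real_analytic_at g \<zeta>"
  then obtain \<theta> \<delta> a where \<delta>: "\<delta> > 0" and \<theta>: "\<zeta> = (\<chi> i. cis (\<theta> $ i))"
    and sum: "\<And>t. t \<in> cbox (\<chi> i. \<theta> $ i - \<delta>) (\<chi> i. \<theta> $ i + \<delta>) \<Longrightarrow> (\<lambda>k. norm (mpower_term a \<theta> t k)) summable_on UNIV"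
    and eq: "\<And>t. t \<in> cbox (\<chi> i. \<theta> $ i - \<delta>) (\<chi> i. \<theta> $ i + \<delta>) \<Longrightarrow> (\<Sum>\<^sub>\<infinity>k. mpower_term a \<theta> t k) = g (\<chi> i. cis (t $ i))"
    unfolding real_analytic_at_def Let_def by blast
  \<comment> \<open>At the corner every monomial attains its maximum modulus \<open>\<delta> ^ (\<Sum>i\<in>UNIV. k i)\<close>.\<close>
  define corner where "corner = (\<chi> i. \<theta> $ i + \<delta>)"
  define M where "M = (\<Sum>\<^sub>\<infinity>k. norm (mpower_term a \<theta> corner k))"
  have sumc: "(\<lambda>k. norm (mpower_term a \<theta> corner k)) summable_on UNIV"
    using \<delta> by (intro sum) (auto simp: mem_box_cart corner_def)
  have M: "norm (a k) * \<delta> ^ (\<Sum>i\<in>UNIV. k i) \<le> M" for k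
  proof -
    have "norm (mpower_term a \<theta> corner k) \<le> M"
      using finite_sum_le_infsum[OF sumc, of "{k}"] by (simp add: M_def)
    then show ?thesis
      using \<delta> by (simp add: mpower_term_def corner_def norm_mult power_sum prod_nonneg flip: of_real_power of_real_prod)
  qed
  obtain m :: nat where m: "max 1 (max M (1 / \<delta>)) < real m"
    using reals_Archimedean2 by blast
  then have m0: "0 < m" and m1: "1 < m * \<delta>"
    using \<delta> by (auto simp: field_simps)
  have "norm (a k) \<le> real m ^ Suc (\<Sum>i\<in>UNIV. k i)" for k
  proof -
    let ?n = "\<Sum>i\<in>UNIV. k i"
    have "norm (a k) * 1 \<le> norm (a k) * (real m * \<delta>) ^ ?n"
      using m1 by (intro mult_left_mono one_le_power) auto
    also have "\<dots> = (norm (a k) * \<delta> ^ ?n) * real m ^ ?n"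
      by (simp add: power_mult_distrib)
    also have "\<dots> \<le> real m * real m ^ ?n"
      using M[of k] m by (intro mult_right_mono) auto
    finally show ?thesis by simp
  qed
  then have "a \<in> bounded_coeffs m"
    by (auto simp: bounded_coeffs_def)
  moreover have "has_chart m g \<zeta> a"
    unfolding has_chart_def
  proof
    fix s :: "real ^ 'n" assume s: "s \<in> small_cube m"
    have "1 / (2 * real m) \<le> \<delta>"
      using m0 m1 \<delta> by (simp add: field_simps)
    then have "\<bar>s $ i\<bar> \<le> \<delta>" for i
      using s by (auto simp: small_cube_def intro: order.trans)
    then have "\<theta> + s \<in> cbox (\<chi> i. \<theta> $ i - \<delta>) (\<chi> i. \<theta> $ i + \<delta>)"
      by (simp add: mem_box_cart abs_le_iff) (smt (verit))
    from eq[OF this] show "power_series a s = g (rotate_by \<zeta> s)"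
      by (simp add: power_series_def rotate_by_def mpower_term_shift[of a \<theta>] \<theta> cis_mult)
  qed
  ultimately show "\<exists>m>0. \<exists>a\<in>bounded_coeffs m. has_chart m g \<zeta> a"
    using m0 by blast
next
  assume "\<exists>m>0. \<exists>a\<in>bounded_coeffs m. has_chart m g \<zeta> a"
  then obtain m a where m: "0 < m" and a: "a \<in> bounded_coeffs m" and chart: "has_chart m g \<zeta> a"
    by blast
  define \<theta> :: "real ^ 'n" where "\<theta> = (\<chi> i. Arg (\<zeta> $ i))"
  have \<theta>: "\<zeta> = (\<chi> i. cis (\<theta> $ i))"
  proof -
    have "cis (Arg (\<zeta> $ i)) = \<zeta> $ i" for i
    proof -
      have "norm (\<zeta> $ i) = 1"
        using \<zeta> by (simp add: torus_def)
      moreover from this have "\<zeta> $ i \<noteq> 0" by auto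
      ultimately show ?thesis
        by (simp add: cis_Arg sgn_div_norm)
    qed
    then show ?thesis by (simp add: \<theta>_def vec_eq_iff)
  qed
  let ?\<delta> = "1 / (2 * real m)"
  let ?B = "cbox (\<chi> i. \<theta> $ i - ?\<delta>) (\<chi> i. \<theta> $ i + ?\<delta>) :: (real ^ 'n) set"
  have small: "t - \<theta> \<in> small_cube m" if "t \<in> ?B" for t
    using that by (auto simp: mem_box_cart small_cube_def abs_le_iff algebra_simps)
  have bound: "norm (mpower_term a \<theta> t k) \<le> real m * (\<Prod>i\<in>UNIV. (1 / 2) ^ k i)" if "t \<in> ?B" for t k
    unfolding mpower_term_shift[of a \<theta>] by (rule norm_mpower_term_le[OF m a small[OF that]])
  show "real_analytic_at g \<zeta>"
    unfolding real_analytic_at_def Let_def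
  proof (intro exI[of _ \<theta>] exI[of _ ?\<delta>] exI[of _ a] conjI ballI \<theta>)
    show "0 < ?\<delta>" using m by simp
  next
    fix t assume t: "t \<in> ?B"
    show "(\<lambda>k. norm (mpower_term a \<theta> t k)) summable_on UNIV"
      by (rule summable_on_comparison_test[OF summable_on_majorant]) (use bound[OF t] in auto)
    have "rotate_by \<zeta> (t - \<theta>) = (\<chi> i. cis (t $ i))"
      by (simp add: rotate_by_def \<theta> cis_mult)
    then show "(\<Sum>\<^sub>\<infinity>k. mpower_term a \<theta> t k) = g (\<chi> i. cis (t $ i))"
      using chart small[OF t] by (simp add: has_chart_def power_series_def mpower_term_shift[of a \<theta>])
  next
    show "uniform_limit ?B (\<lambda>K t. \<Sum>k\<in>K. mpower_term a \<theta> t k)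
        (\<lambda>t. \<Sum>\<^sub>\<infinity>k. mpower_term a \<theta> t k) (finite_subsets_at_top UNIV)"
      by (rule Weierstrass_m_test_general[OF bound summable_on_majorant])
  qed
qed

text \<open>Compactness in the topology of pointwise convergence of coefficients, by Tychonoff.\<close>

lemma compact_bounded_coeffs: "compact (bounded_coeffs m :: (('n::finite \<Rightarrow> nat) \<Rightarrow> complex) set)"
proof -
  have "compactin (product_topology (\<lambda>_. euclidean) UNIV)
      (PiE UNIV (\<lambda>k :: 'n \<Rightarrow> nat. cball 0 (real m ^ Suc (\<Sum>i\<in>UNIV. k i)) :: complex set))"
    by (simp add: compactin_PiE del: power_Suc)
  then show ?thesis
    by (simp add: bounded_coeffs_def euclidean_product_topology del: power_Suc)
qed

lemma continuous_on_power_series_coeffs: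
  assumes "0 < m" "s \<in> small_cube m"
  shows "continuous_on (bounded_coeffs m) (\<lambda>a. power_series a s)"
  unfolding power_series_def
proof (rule uniform_limit_theorem)
  show "uniform_limit (bounded_coeffs m) (\<lambda>K a. \<Sum>k\<in>K. mpower_term a 0 s k)
      (\<lambda>a. \<Sum>\<^sub>\<infinity>k. mpower_term a 0 s k) (finite_subsets_at_top UNIV)"
    using assms by (intro Weierstrass_m_test_general[OF norm_mpower_term_le summable_on_majorant]) auto
  have "continuous_on (bounded_coeffs m) (\<lambda>a. a k)" for k :: "'a \<Rightarrow> nat"
    by (rule continuous_on_subset[OF continuous_on_product_coordinates]) simp
  then show "\<forall>\<^sub>F K in finite_subsets_at_top UNIV. continuous_on (bounded_coeffs m) (\<lambda>a. \<Sum>k\<in>K. mpower_term a 0 s k)"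
    unfolding mpower_term_def by (intro always_eventually allI continuous_intros)
qed simp

section \<open>The set of nowhere analytic functions is a countable intersection of open sets\<close>

lemma rotate_by_in_torus: "\<zeta> \<in> torus \<Longrightarrow> rotate_by \<zeta> s \<in> torus"
  by (simp add: torus_def rotate_by_def norm_mult)

lemma bounded_polydisc: "bounded (polydisc :: (complex ^ 'n::finite) set)"
proof (rule boundedI)
  fix z :: "complex ^ 'n" assume "z \<in> polydisc"
  then have "(\<Sum>i\<in>UNIV. norm (z $ i)) \<le> (\<Sum>i\<in>(UNIV :: 'n set). 1)"
    by (intro sum_mono) (simp add: polydisc_def less_imp_le)
  moreover have "norm z \<le> (\<Sum>i\<in>UNIV. norm (z $ i))"
    unfolding norm_vec_def by (rule L2_set_le_sum) simp
  ultimately show "norm z \<le> real CARD('n)"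
    by simp
qed

lemma compact_torus: "compact (torus :: (complex ^ 'n::finite) set)"
proof -
  have "torus = (\<Inter>i. {z :: complex ^ 'n. norm (z $ i) = 1})"
    by (auto simp: torus_def)
  also have "closed \<dots>"
    by (intro closed_INT ballI closed_Collect_eq continuous_intros)
  finally have "compact (closure polydisc \<inter> torus :: (complex ^ 'n) set)"
    by (intro compact_Int_closed) (simp_all add: bounded_polydisc)
  then show ?thesis
    by (metis Int_absorb1 torus_subset_closure_polydisc)
qed

lemma norm_cont_extension_diff_le_seminorm:
  assumes "f \<in> Ap p" "g \<in> Ap p" "z \<in> closure polydisc"
  shows "norm (cont_extension g z - cont_extension f z) \<le> Ap_seminorm (\<lambda>_. 0) (\<lambda>z. g z - f z)"
proof (rule norm_cont_extension_diff_le[OF _ _ _ assms(3)])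
  show ext: "extends_to_closure g (cont_extension g)" "extends_to_closure f (cont_extension f)"
    using assms by (auto intro: extends_to_closure_cont_extension)
  let ?d = "\<lambda>z. cont_extension g z - cont_extension f z"
  have "continuous_on (closure polydisc) ?d"
    using ext by (auto simp: extends_to_closure_def intro!: continuous_intros)
  then have "bounded (?d ` closure polydisc)"
    using bounded_polydisc by (intro compact_imp_bounded compact_continuous_image) auto
  then obtain B where B: "\<And>z. z \<in> closure polydisc \<Longrightarrow> norm (?d z) \<le> B"
    unfolding bounded_iff by blast
  fix z :: "complex ^ 'a" assume z: "z \<in> polydisc"
  have "bdd_above ((\<lambda>z. norm (g z - f z)) ` polydisc)"
  proof (rule bdd_aboveI2)
    fix z :: "complex ^ 'a" assume "z \<in> polydisc"
    then show "norm (g z - f z) \<le> B"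
      using B[of z] ext closure_subset by (auto simp: extends_to_closure_def)
  qed
  then show "norm (g z - f z) \<le> Ap_seminorm (\<lambda>_. 0) (\<lambda>z. g z - f z)"
    unfolding Ap_seminorm_def multi_deriv_0 by (rule cSUP_upper[OF z])
qed

lemma openin_seminorm_ball:
  assumes "f \<in> Ap p" "0 < \<epsilon>"
  shows "openin (Ap_topology p) {g \<in> Ap p. Ap_seminorm (\<lambda>_. 0) (\<lambda>z. g z - f z) < \<epsilon>}"
  unfolding Ap_topology_def
  by (rule topology_generated_by_Basis) (use assms zero_in_mindices in blast)

text \<open>Joint continuity in the function and the point: the seminorm of order \<open>0\<close> controls the extension
  uniformly, and each single extension is continuous.\<close>

lemma continuous_map_cont_extension:
  fixes \<phi> :: "'b::topological_space \<Rightarrow> complex ^ 'n::finite"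
  assumes \<phi>: "continuous_on T \<phi>" "\<phi> ` T \<subseteq> closure polydisc"
  shows "continuous_map (prod_topology (Ap_topology p) (top_of_set T)) euclidean
    (\<lambda>x. cont_extension (fst x) (\<phi> (snd x)))"
  unfolding mtopology_is_euclidean[symmetric] Met_TC.continuous_map_to_metric
proof (intro ballI allI impI)
  fix x :: "(complex ^ 'n \<Rightarrow> complex) \<times> 'b" and \<epsilon> :: real
  assume x: "x \<in> topspace (prod_topology (Ap_topology p) (top_of_set T))" and \<epsilon>: "0 < \<epsilon>"
  obtain f y where xy: "x = (f, y)" and f: "f \<in> Ap p" and y: "y \<in> T"
    using x by (auto simp: topspace_Ap_topology)
  define V where "V = {z \<in> T. cont_extension f (\<phi> z) \<in> ball (cont_extension f (\<phi> y)) (\<epsilon> / 2)}"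
  define U where "U = {g \<in> Ap p. Ap_seminorm (\<lambda>_. 0) (\<lambda>z. g z - f z) < \<epsilon> / 2}"
  have "continuous_on (closure polydisc) (cont_extension f)"
    using extends_to_closure_cont_extension[OF f] by (simp add: extends_to_closure_def)
  then have "continuous_on T (\<lambda>z. cont_extension f (\<phi> z))"
    using \<phi> by (rule continuous_on_compose2)
  from continuous_openin_preimage_gen[OF this open_ball] have "openin (top_of_set T) V"
    unfolding V_def vimage_def Int_def mem_Collect_eq .
  moreover have "openin (Ap_topology p) U"
    unfolding U_def using f \<epsilon> by (intro openin_seminorm_ball) auto
  ultimately have "openin (prod_topology (Ap_topology p) (top_of_set T)) (U \<times> V)"
    by (simp add: openin_prod_Times_iff)
  moreover have "x \<in> U \<times> V"
    using f y \<epsilon> zero_in_polydisc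
    by (auto simp: xy U_def V_def Ap_seminorm_def multi_deriv_0 image_constant_conv)
  moreover have "cont_extension (fst u) (\<phi> (snd u)) \<in> Met_TC.mball (cont_extension (fst x) (\<phi> (snd x))) \<epsilon>"
    if u: "u \<in> U \<times> V" for u
  proof -
    obtain g z where gz: "u = (g, z)" "g \<in> U" "z \<in> V" using u by auto
    have "norm (cont_extension g (\<phi> z) - cont_extension f (\<phi> z)) \<le> Ap_seminorm (\<lambda>_. 0) (\<lambda>z. g z - f z)"
      using gz f \<phi>(2) by (intro norm_cont_extension_diff_le_seminorm) (auto simp: U_def V_def)
    then have "dist (cont_extension f (\<phi> z)) (cont_extension g (\<phi> z)) < \<epsilon> / 2"
      using gz(2) by (simp add: U_def dist_norm norm_minus_commute)
    moreover have "dist (cont_extension f (\<phi> y)) (cont_extension f (\<phi> z)) < \<epsilon> / 2"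
      using gz(3) by (simp add: V_def)
    ultimately show ?thesis
      unfolding gz xy fst_conv snd_conv Met_TC.in_mball
      using dist_triangle_half_r[of "cont_extension f (\<phi> z)" "cont_extension f (\<phi> y)" \<epsilon> "cont_extension g (\<phi> z)"]
      by (simp add: dist_commute)
  qed
  ultimately show "\<exists>U. openin (prod_topology (Ap_topology p) (top_of_set T)) U \<and> x \<in> U \<and>
      (\<forall>u\<in>U. cont_extension (fst u) (\<phi> (snd u)) \<in> Met_TC.mball (cont_extension (fst x) (\<phi> (snd x))) \<epsilon>)"
    by blast
qed

text \<open>For fixed \<open>s\<close> the equation in \<open>has_chart\<close> is a closed condition on \<open>(f, \<zeta>, a)\<close>. The pairs
  \<open>(\<zeta>, a)\<close> range over a compact space, so projecting to \<open>f\<close> keeps the set closed. Letting \<open>\<zeta>\<close> vary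
  in a compact set treats a single point and the whole torus alike.\<close>

lemma closedin_has_chart:
  fixes Z :: "(complex ^ 'n::finite) set"
  assumes Z: "compact Z" "Z \<subseteq> torus" and m: "0 < m"
  shows "closedin (Ap_topology p) {f \<in> Ap p. \<exists>\<zeta>\<in>Z. \<exists>a\<in>bounded_coeffs m. has_chart m (cont_extension f) \<zeta> a}"
proof -
  define T where "T = Z \<times> (bounded_coeffs m :: (('n \<Rightarrow> nat) \<Rightarrow> complex) set)"
  let ?X = "prod_topology (Ap_topology p) (top_of_set T)"
  define h where "h s x = power_series (snd (snd x)) s - cont_extension (fst x) (rotate_by (fst (snd x)) s)"
    for s :: "real ^ 'n" and x :: "(complex ^ 'n \<Rightarrow> complex) \<times> ((complex ^ 'n) \<times> (('n \<Rightarrow> nat) \<Rightarrow> complex))"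
  have "compact T"
    unfolding T_def by (intro compact_Times Z compact_bounded_coeffs)
  then have "closed_map ?X (Ap_topology p) fst"
    by (intro closed_map_fst compact_space_subtopology) simp
  moreover have "closedin ?X (\<Inter>s\<in>small_cube m. {x \<in> topspace ?X. h s x \<in> {0}})"
  proof (rule closedin_INT)
    show "(small_cube m :: (real ^ 'n) set) \<noteq> {}"
      using m by (auto simp: small_cube_def intro!: exI[of _ 0])
    fix s :: "real ^ 'n" assume s: "s \<in> small_cube m"
    have "continuous_on T (\<lambda>y. power_series (snd y) s)"
      by (rule continuous_on_compose2[OF continuous_on_power_series_coeffs[OF m s]])
         (auto simp: T_def intro!: continuous_on_snd continuous_on_id)
    then have "continuous_map ?X euclidean ((\<lambda>y. power_series (snd y) s) \<circ> snd)"
      by (intro continuous_map_compose[OF continuous_map_snd]) simp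
    then have 1: "continuous_map ?X euclidean (\<lambda>x. power_series (snd (snd x)) s)"
      by (simp add: o_def)
    have 2: "continuous_map ?X euclidean (\<lambda>x. cont_extension (fst x) (rotate_by (fst (snd x)) s))"
    proof (rule continuous_map_cont_extension)
      show "continuous_on T (\<lambda>y. rotate_by (fst y) s)"
        unfolding rotate_by_def by (intro continuous_intros)
      show "(\<lambda>y. rotate_by (fst y) s) ` T \<subseteq> closure polydisc"
        using Z(2) rotate_by_in_torus torus_subset_closure_polydisc by (fastforce simp: T_def)
    qed
    have "continuous_map ?X euclidean (h s)"
      unfolding h_def using 1 2 by (rule continuous_map_diff)
    then show "closedin ?X {x \<in> topspace ?X. h s x \<in> {0}}"
      by (rule closedin_continuous_map_preimage) simp
  qed
  ultimately have "closedin (Ap_topology p) (fst ` (\<Inter>s\<in>small_cube m. {x \<in> topspace ?X. h s x \<in> {0}}))"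
    unfolding closed_map_def by blast
  also have "fst ` (\<Inter>s\<in>small_cube m. {x \<in> topspace ?X. h s x \<in> {0}}) =
      {f \<in> Ap p. \<exists>\<zeta>\<in>Z. \<exists>a\<in>bounded_coeffs m. has_chart m (cont_extension f) \<zeta> a}"
  proof -
    have "0 \<in> (small_cube m :: (real ^ 'n) set)"
      by (simp add: small_cube_def)
    then show ?thesis
      by (force simp: topspace_Ap_topology T_def h_def has_chart_def image_iff)
  qed
  finally show ?thesis .
qed

lemma gdelta_in_not_analytic_on:
  fixes Z :: "(complex ^ 'n::finite) set"
  assumes Z: "compact Z" "Z \<subseteq> torus"
  shows "gdelta_in (Ap_topology p) {f \<in> Ap p. \<forall>\<zeta>\<in>Z. \<not> Ap_real_analytic_at f \<zeta>}"
proof -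
  define E where "E m = {f \<in> Ap p. \<exists>\<zeta>\<in>Z. \<exists>a\<in>bounded_coeffs m. has_chart m (cont_extension f) \<zeta> a}" for m
  have "fsigma_in (Ap_topology p) (\<Union>m. E (Suc m))"
    by (intro fsigma_in_Union) (auto simp: E_def intro!: closed_imp_fsigma_in closedin_has_chart Z)
  then have "gdelta_in (Ap_topology p) (topspace (Ap_topology p) - (\<Union>m. E (Suc m)))"
    by (intro gdelta_in_diff) auto
  also have "topspace (Ap_topology p) - (\<Union>m. E (Suc m)) = {f \<in> Ap p. \<forall>\<zeta>\<in>Z. \<not> Ap_real_analytic_at f \<zeta>}"
  proof -
    have "Ap_real_analytic_at f \<zeta> \<longleftrightarrow> (\<exists>m. \<exists>a\<in>bounded_coeffs (Suc m). has_chart (Suc m) (cont_extension f) \<zeta> a)"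
      if "\<zeta> \<in> Z" for f \<zeta>
    proof -
      have ex_Suc: "(\<exists>m>0. P m) \<longleftrightarrow> (\<exists>m. P (Suc m))" for P
        by (metis gr0_conv_Suc)
      have "\<zeta> \<in> torus"
        using that Z(2) by blast
      then show ?thesis
        by (simp only: Ap_real_analytic_at_def real_analytic_at_iff_has_chart ex_Suc)
    qed
    then show ?thesis
      by (auto simp: E_def topspace_Ap_topology)
  qed
  finally show ?thesis .
qed

section \<open>Density of the nowhere analytic functions\<close>

text \<open>Analyticity in the angle of coordinate \<open>i\<close> alone, at the point with angles \<open>t\<close>, expressed by a
  holomorphic germ in a complex angle.\<close>

definition line_analytic :: "(complex ^ 'n::finite \<Rightarrow> complex) \<Rightarrow> 'n \<Rightarrow> real ^ 'n \<Rightarrow> bool" where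
  "line_analytic g i t \<longleftrightarrow> (\<exists>r>0. \<exists>F. F holomorphic_on ball 0 r \<and>
     (\<forall>x. \<bar>x\<bar> < r \<longrightarrow> F (of_real x) = g (\<chi> l. cis (t $ l + (if l = i then x else 0)))))"

text \<open>Inside the cube of convergence all but one of the variables can be frozen at any point, and
  the power series stays convergent when the remaining variable becomes complex. Passing to an open
  set of base points is what permits a countable choice of them later.\<close>

lemma line_analytic_near_real_analytic:
  fixes g :: "complex ^ 'n::finite \<Rightarrow> complex"
  assumes "real_analytic_at g \<zeta>"
  obtains U where "open U" "U \<noteq> {}" "\<And>t. t \<in> U \<Longrightarrow> line_analytic g i t"
proof -
  obtain \<theta> where \<theta>: "\<zeta> = (\<chi> l. cis (\<theta> $ l))"
    using assms unfolding real_analytic_at_def by blast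
  then have "\<zeta> \<in> torus"
    by (simp add: torus_def)
  then obtain m a where m: "0 < m" and a: "a \<in> bounded_coeffs m" and chart: "has_chart m g \<zeta> a"
    using assms by (auto simp: real_analytic_at_iff_has_chart)
  define \<rho> where "\<rho> = 1 / (2 * real m)"
  define U where "U = {t :: real ^ 'n. \<forall>l. \<bar>t $ l - \<theta> $ l\<bar> < \<rho>}"
  have "U = (\<Inter>l. {t. \<bar>t $ l - \<theta> $ l\<bar> < \<rho>})"
    by (auto simp: U_def)
  then have "open U"
    by (auto intro!: open_INT open_Collect_less continuous_intros)
  moreover have "\<theta> \<in> U"
    using m by (simp add: U_def \<rho>_def)
  moreover have "line_analytic g i t" if t: "t \<in> U" for t
  proof -
    define s where "s = t - \<theta>"
    have s: "\<bar>s $ l\<bar> < \<rho>" for l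
      using t by (simp add: s_def U_def)
    define r where "r = \<rho> - \<bar>s $ i\<bar>"
    have r: "0 < r"
      using s[of i] by (simp add: r_def)
    define v where "v w l = complex_of_real (s $ l) + (if l = i then w else 0)" for w l
    define F where "F w = (\<Sum>\<^sub>\<infinity>k. a k * (\<Prod>l\<in>UNIV. v w l ^ k l))" for w
    \<comment> \<open>The radius \<open>r\<close> is the distance from \<open>s $ i\<close> to the faces of the cube.\<close>
    have v_le: "norm (v w l) \<le> \<rho>" if "w \<in> cball 0 r" for w l
    proof -
      have "norm (v w l) \<le> \<bar>s $ l\<bar> + (if l = i then norm w else 0)"
        unfolding v_def by (rule norm_triangle_le) simp
      then show ?thesis
        using that s[of l] by (auto simp: r_def split: if_splits)
    qed
    have ulim: "uniform_limit (cball 0 r) (\<lambda>K w. \<Sum>k\<in>K. a k * (\<Prod>l\<in>UNIV. v w l ^ k l)) F (finite_subsets_at_top UNIV)"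
      unfolding F_def
      by (rule Weierstrass_m_test_general[OF norm_coeff_times_prod_le[OF m a] summable_on_majorant])
         (use v_le in \<open>simp add: \<rho>_def\<close>)
    have "(\<lambda>w. v w l) holomorphic_on UNIV" for l
      unfolding v_def by (cases "l = i") (auto intro!: holomorphic_intros)
    then have "(\<lambda>w. \<Sum>k\<in>K. a k * (\<Prod>l\<in>UNIV. v w l ^ k l)) holomorphic_on UNIV" for K
      by (intro holomorphic_intros)
    then have hol: "continuous_on (cball 0 r) (\<lambda>w. \<Sum>k\<in>K. a k * (\<Prod>l\<in>UNIV. v w l ^ k l)) \<and>
        (\<lambda>w. \<Sum>k\<in>K. a k * (\<Prod>l\<in>UNIV. v w l ^ k l)) holomorphic_on ball 0 r" for K
      by (meson holomorphic_on_imp_continuous_on holomorphic_on_subset subset_UNIV)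
    have "F holomorphic_on ball 0 r"
      by (rule holomorphic_uniform_limit[OF always_eventually[OF allI[OF hol]] ulim]) simp_all
    moreover have "F (of_real x) = g (\<chi> l. cis (t $ l + (if l = i then x else 0)))" if x: "\<bar>x\<bar> < r" for x
    proof -
      define s' where "s' = (\<chi> l. s $ l + (if l = i then x else 0))"
      have s': "v (of_real x) l = of_real (s' $ l)" for l
        by (simp add: v_def s'_def)
      have "\<bar>s' $ l\<bar> \<le> \<rho>" for l
        using v_le[of "of_real x" l] x by (simp add: s')
      then have "s' \<in> small_cube m"
        by (simp add: small_cube_def \<rho>_def)
      then have "power_series a s' = g (rotate_by \<zeta> s')"
        using chart by (simp add: has_chart_def)
      moreover have "F (of_real x) = power_series a s'"
        by (simp add: F_def power_series_def mpower_term_def s')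
      moreover have "rotate_by \<zeta> s' = (\<chi> l. cis (t $ l + (if l = i then x else 0)))"
        by (simp add: rotate_by_def \<theta> cis_mult s'_def s_def vec_eq_iff algebra_simps)
      ultimately show ?thesis by simp
    qed
    ultimately show ?thesis
      unfolding line_analytic_def using r by blast
  qed
  ultimately show thesis
    using that by blast
qed

text \<open>The difference of the two functions would make the lacunary series itself analytic at an angle.\<close>

lemma not_line_analytic_twice:
  fixes e g h :: "complex ^ 'n::finite \<Rightarrow> complex"
  assumes "c \<noteq> d"
    and g: "\<And>z. z \<in> torus \<Longrightarrow> g z = e z + c * lacunary 0 (z $ i)"
    and h: "\<And>z. z \<in> torus \<Longrightarrow> h z = e z + d * lacunary 0 (z $ i)"
    and "line_analytic g i t" "line_analytic h i t"
  shows False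
proof -
  define z where "z x = (\<chi> l. cis (t $ l + (if l = i then x else 0)))" for x
  have z: "z x \<in> torus" for x
    by (simp add: z_def torus_def)
  obtain r F where F: "r > 0" "F holomorphic_on ball 0 r" "\<And>x. \<bar>x\<bar> < r \<Longrightarrow> F (of_real x) = g (z x)"
    using assms(4) unfolding line_analytic_def z_def by blast
  obtain r' G where G: "r' > 0" "G holomorphic_on ball 0 r'" "\<And>x. \<bar>x\<bar> < r' \<Longrightarrow> G (of_real x) = h (z x)"
    using assms(5) unfolding line_analytic_def z_def by blast
  show False
  proof (rule boundary_not_analytic[of "min r r'" "\<lambda>w. (F w - G w) / (c - d)" "t $ i"])
    show "(\<lambda>w. (F w - G w) / (c - d)) holomorphic_on ball 0 (min r r')"
      using F(2) G(2) assms(1) by (intro holomorphic_intros) (auto elim: holomorphic_on_subset)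
    fix x :: real assume x: "\<bar>x\<bar> < min r r'"
    have "F (of_real x) - G (of_real x) = (c - d) * lacunary 0 (z x $ i)"
      using F(3) G(3) x z[of x] by (simp add: g h algebra_simps)
    then show "(F (of_real x) - G (of_real x)) / (c - d) = lacunary 0 (cis (t $ i + x))"
      using assms(1) by (simp add: z_def)
  qed (use F G in auto)
qed

text \<open>Each \<open>c\<close> in the set gives an open set of base points at which the perturbed function is
  analytic in one angle, hence such a point in a fixed countable dense set; and no base point serves
  two different \<open>c\<close>.\<close>

lemma countable_analytic_perturbations:
  fixes f :: "complex ^ 'n::finite \<Rightarrow> complex"
  assumes f: "f \<in> Ap p"
  shows "countable {c. \<exists>\<zeta>\<in>torus. Ap_real_analytic_at (perturb c f) \<zeta>}"
proof -
  obtain D :: "(real ^ 'n) set" where D: "countable D" "\<And>U. open U \<Longrightarrow> U \<noteq> {} \<Longrightarrow> \<exists>d\<in>D. d \<in> U"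
    using countable_dense_setE[where 'a = "real ^ 'n"] by metis
  have ext: "cont_extension (perturb c f) z = cont_extension f z + c * lacunary 0 (z $ slot)" if "z \<in> torus" for c z
    using cont_extension_perturb[OF f] that torus_subset_closure_polydisc by blast
  let ?L = "\<lambda>t. {c. line_analytic (cont_extension (perturb c f)) slot t}"
  have "{c. \<exists>\<zeta>\<in>torus. Ap_real_analytic_at (perturb c f) \<zeta>} \<subseteq> (\<Union>t\<in>D. ?L t)"
  proof clarify
    fix c and \<zeta> :: "complex ^ 'n" assume analytic: "Ap_real_analytic_at (perturb c f) \<zeta>"
    obtain U where "open U" "U \<noteq> {}" "\<And>t. t \<in> U \<Longrightarrow> line_analytic (cont_extension (perturb c f)) slot t"
      using line_analytic_near_real_analytic[OF analytic[unfolded Ap_real_analytic_at_def], of slot] by blast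
    with D(2) show "c \<in> (\<Union>t\<in>D. ?L t)"
      by blast
  qed
  moreover have "countable (?L t)" for t
  proof -
    have "c = d" if "c \<in> ?L t" "d \<in> ?L t" for c d
      using not_line_analytic_twice[OF _ ext ext, of c d t] that by blast
    then have "?L t \<subseteq> {SOME c. c \<in> ?L t}"
      by (metis (no_types, lifting) singleton_iff someI subsetI)
    then show ?thesis
      by (rule countable_subset) simp
  qed
  ultimately show ?thesis
    using D(1) by (meson countable_UN countable_subset)
qed

lemma dense_nowhere_analytic:
  "Ap_topology p closure_of {f \<in> Ap p. \<forall>\<zeta>\<in>(torus :: (complex ^ 'n::finite) set). \<not> Ap_real_analytic_at f \<zeta>} =
    topspace (Ap_topology p)"
  unfolding dense_intersects_open
proof (intro allI impI, elim conjE)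
  fix U :: "(complex ^ 'n \<Rightarrow> complex) set" assume U: "openin (Ap_topology p) U" "U \<noteq> {}"
  then obtain f where f: "f \<in> U" by blast
  then have "f \<in> Ap p"
    using openin_subset[OF U(1)] by (auto simp: topspace_Ap_topology)
  obtain \<epsilon> where \<epsilon>: "\<epsilon> > 0" "\<And>c. norm c < \<epsilon> \<Longrightarrow> perturb c f \<in> U"
    using openin_Ap_topology_perturb[OF U(1) f] by blast
  let ?bad = "{c. \<exists>\<zeta>\<in>torus. Ap_real_analytic_at (perturb c f) \<zeta>}"
  have "\<not> ball 0 \<epsilon> \<subseteq> ?bad"
    using countable_analytic_perturbations[OF \<open>f \<in> Ap p\<close>] uncountable_ball[OF \<epsilon>(1), of "0 :: complex"] countable_subset
    by blast
  then obtain c where "c \<in> ball 0 \<epsilon>" "c \<notin> ?bad"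
    by blast
  then have "norm c < \<epsilon>" "\<forall>\<zeta>\<in>torus. \<not> Ap_real_analytic_at (perturb c f) \<zeta>"
    by simp_all
  then show "{f \<in> Ap p. \<forall>\<zeta>\<in>torus. \<not> Ap_real_analytic_at f \<zeta>} \<inter> U \<noteq> {}"
    using \<epsilon>(2) perturb_in_Ap[OF \<open>f \<in> Ap p\<close>] by blast
qed

theorem theorem10:
  fixes p :: enat
  shows "(\<forall>\<zeta>\<in>(torus :: (complex ^ 'n::finite) set).
            dense_gdelta_in (Ap_topology p) {f \<in> Ap p. \<not> Ap_real_analytic_at f \<zeta>}) \<and>
         dense_gdelta_in (Ap_topology p)
            {f \<in> Ap p. \<forall>\<zeta>\<in>(torus :: (complex ^ 'n) set). \<not> Ap_real_analytic_at f \<zeta>}"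
proof (intro conjI ballI)
  show "dense_gdelta_in (Ap_topology p)
      {f \<in> Ap p. \<forall>\<zeta>\<in>(torus :: (complex ^ 'n) set). \<not> Ap_real_analytic_at f \<zeta>}"
    unfolding dense_gdelta_in_def
    using gdelta_in_not_analytic_on[OF compact_torus order_refl] dense_nowhere_analytic by blast
next
  fix \<zeta> :: "complex ^ 'n" assume \<zeta>: "\<zeta> \<in> torus"
  have "gdelta_in (Ap_topology p) {f \<in> Ap p. \<not> Ap_real_analytic_at f \<zeta>}"
    using gdelta_in_not_analytic_on[of "{\<zeta>}" p] \<zeta> by simp
  moreover have "Ap_topology p closure_of {f \<in> Ap p. \<forall>\<zeta>\<in>(torus :: (complex ^ 'n) set). \<not> Ap_real_analytic_at f \<zeta>}
      \<subseteq> Ap_topology p closure_of {f \<in> Ap p. \<not> Ap_real_analytic_at f \<zeta>}"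
    using \<zeta> by (intro closure_of_mono) blast
  ultimately show "dense_gdelta_in (Ap_topology p) {f \<in> Ap p. \<not> Ap_real_analytic_at f \<zeta>}"
    unfolding dense_gdelta_in_def dense_nowhere_analytic
    by (meson closure_of_subset_topspace subset_antisym)
qed

end
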